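(* Consider the system $x(t+1)=Ax(t)+Bu(t)$ subject to $\underline y\le Ex(t)+Fu(t)\le\overline y$, controlled with the HMPC formulation described in the context, under the assumptions listed there, and assume that $N$ is greater than or equal to the controllability index of the system. Then, for any reference $(x_r,u_r)\in\mathbb R^n\times\mathbb R^m$ and any initial state $x(t)\in\mathbb R^n$ belonging to the feasibility region of $\mathbb H(x(t);x_r,u_r)$, the system controlled by the HMPC formulation's control law is stable, fulfills the system constraints at all future time instants, and asymptotically converges to the optimal artificial harmonic reference, which is the admissible steady state $(x_e^\circ,u_e^\circ)\in\mathbb R^n\times\mathbb R^m$ described in the context.
   Context: System: $x(t+1)=Ax(t)+Bu(t)$, $x(t)\in\mathbb R^n$, $u(t)\in\mathbb R^m$, $(A,B)$ controllable, with constraint set $\mathcal Y=\{(x,u):\underline y\le Ex+Fu\le\overline y\}$, where $\underline y,\overline y\in\mathbb R^p$, $E\in\mathbb R^{p\times n}$, $F\in\mathbb R^{p\times m}$ and $\mathcal Y$ has non-empty interior. The controllability index is the smallest integer $j>0$ with $\mathrm{rank}[B,AB,\dots,A^{j-1}B]=n$. $N\ge1$ is an integer (prediction horizon), $w\ge0$ a real number (base frequency), $\varepsilon_y\in\mathbb R^p$ a vector with (arbitrarily small) positive components with $\underline y+\varepsilon_y<\overline y-\varepsilon_y$. Vector inequalities are componentwise; $v_{(i)}$ is the $i$-th component of $v$; $\|v\|_M^2=v^\top Mv$. Cost matrices: $Q\in\mathbb R^{n\times n}$, $R\in\mathbb R^{m\times m}$ symmetric positive definite; $T_e,T_h\in\mathbb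 R^{n\times n}$ and $S_e,S_h\in\mathbb R^{m\times m}$ diagonal positive definite. HMPC problem $\mathbb H(x(t);x_r,u_r)$: decision variables $\mathbf x=(x_0,\dots)$, $\mathbf u=(u_0,\dots,u_{N-1})$, $x_e,x_s,x_c\in\mathbb R^n$, $u_e,u_s,u_c\in\mathbb R^m$. With $x_{hj}=x_e+x_s\sin(w(j-N))+x_c\cos(w(j-N))$, $u_{hj}=u_e+u_s\sin(w(j-N))+u_c\cos(w(j-N))$, $y_e=Ex_e+Fu_e$, $y_s=Ex_s+Fu_s$, $y_c=Ex_c+Fu_c$, and offset cost $$V_h=\|x_e-x_r\|_{T_e}^2+\|u_e-u_r\|_{S_e}^2+\|x_s\|_{T_h}^2+\|x_c\|_{T_h}^2+\|u_s\|_{S_h}^2+\|u_c\|_{S_h}^2,$$ minimize $\sum_{j=0}^{N-1}\left(\|x_j-x_{hj}\|_Q^2+\|u_j-u_{hj}\|_R^2\right)+V_h$ subject to: $x_{j+1}=Ax_j+Bu_j$ and $\underline y\le Ex_j+Fu_j\le\overline y$ for $0\le j\le N-1$; $x_0=x(t)$; $x_N=x_e+x_c$; and the following harmonic constraints (H): $x_e=Ax_e+Bu_e$; $x_s\cos(w)-x_c\sin(w)=Ax_s+Bu_s$; $x_s\sin(w)+x_c\cos(w)=Ax_c+Bu_c$; and, for $1\le i\le p$, $\sqrt{y_{s(i)}^2+y_{c(i)}^2}\le y_{e(i)}-\underline y_{(i)}-\varepsilon_{y(i)}$ and $\sqrt{y_{s(i)}^2+y_{c(i)}^2}\le\overline y_{(i)}-\varepsilon_{y(i)}-y_{e(i)}$.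 The feasibility region is the set of states $x(t)$ for which this problem is feasible. The HMPC control law is: at each time $t$ apply $u(t)=u_0^*$, the first input of the optimal solution of $\mathbb H(x(t);x_r,u_r)$. Optimal artificial harmonic reference: the harmonic sequences $x_{hj}^\circ,u_{hj}^\circ$ parametrized by the unique minimizer of $V_h$ over $(x_e,x_s,x_c,u_e,u_s,u_c)$ satisfying (H). It is constant: $x_{hj}^\circ=x_e^\circ$, $u_{hj}^\circ=u_e^\circ$, where $(x_e^\circ,u_e^\circ)$ minimizes $\|x_e-x_r\|_{T_e}^2+\|u_e-u_r\|_{S_e}^2$ over the steady states $x_e=Ax_e+Bu_e$ with $\underline y+\varepsilon_y\le Ex_e+Fu_e\le\overline y-\varepsilon_y$. *)

theory Defs
  imports "HOL-Analysis.Analysis"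
begin

section \<open>Linear systems\<close>

primrec lti_state ::
  "real^'n^'n \<Rightarrow> real^'m^'n \<Rightarrow> real^'n \<Rightarrow> (nat \<Rightarrow> real^'m) \<Rightarrow> nat \<Rightarrow> real^'n"
where
  "lti_state A B x0 u 0 = x0"
| "lti_state A B x0 u (Suc t) = A *v lti_state A B x0 u t + B *v u t"

definition controllable :: "real^'n^'n \<Rightarrow> real^'m^'n \<Rightarrow> bool" where
  "controllable A B \<longleftrightarrow> (\<forall>x0 x1. \<exists>T u. lti_state A B x0 u T = x1)"

text \<open>
  The rank of the block matrix \<open>[B, AB, ..., A^(j-1) B]\<close> is the dimension of the span of the
  columns of its blocks. (On the type of matrices, \<open>^\<close> is the componentwise power,
  hence the iteration of \<open>**\<close>.)
\<close>

definition ctrb_rank :: "real^'n^'n \<Rightarrow> real^'m^'n \<Rightarrow> nat \<Rightarrow> nat" where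
  "ctrb_rank A B j = dim (\<Union>k<j. columns ((((**) A) ^^ k) B))"

definition controllability_index :: "real^'n^'n \<Rightarrow> real^'m^'n \<Rightarrow> nat" where
  "controllability_index A B = (LEAST j. 0 < j \<and> ctrb_rank A B j = CARD('n))"

text \<open>
  Lyapunov stability of the equilibrium \<open>xe\<close> of \<open>x(t+1) = f (x(t))\<close>, where \<open>X\<close> is the
  positively invariant set of admissible initial states.
\<close>

definition lyapunov_stable :: "('a::metric_space \<Rightarrow> 'a) \<Rightarrow> 'a set \<Rightarrow> 'a \<Rightarrow> bool" where
  "lyapunov_stable f X xe \<longleftrightarrow>
     (\<forall>x\<in>X. f x \<in> X) \<and> xe \<in> X \<and> f xe = xe \<and>
     (\<forall>\<epsilon>>0. \<exists>\<delta>>0. \<forall>x\<in>X. dist x xe < \<delta> \<longrightarrow> (\<forall>t. dist ((f ^^ t) x) xe < \<epsilon>))"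


section \<open>Weighted norms\<close>

definition sq_wnorm :: "real^'k^'k \<Rightarrow> real^'k \<Rightarrow> real" where
  "sq_wnorm M v = v \<bullet> (M *v v)"

definition sym_pos_def :: "real^'k^'k \<Rightarrow> bool" where
  "sym_pos_def M \<longleftrightarrow> transpose M = M \<and> (\<forall>v. v \<noteq> 0 \<longrightarrow> 0 < v \<bullet> (M *v v))"

definition diag_pos_def :: "real^'k^'k \<Rightarrow> bool" where
  "diag_pos_def M \<longleftrightarrow> sym_pos_def M \<and> (\<forall>i j. i \<noteq> j \<longrightarrow> M $ i $ j = 0)"


section \<open>The HMPC problem\<close>

text \<open>
  The data of the problem: system \<open>A, B\<close>; constraints \<open>ylo \<le> E x + F u \<le> yhi\<close>; tightening
  \<open>eps\<close>; cost matrices \<open>Q, R, Te, Th, Se, Sh\<close>; prediction horizon and base frequency.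
\<close>

record ('n::finite, 'm::finite, 'p::finite) hmpc =
  mA :: "real^'n^'n"
  mB :: "real^'m^'n"
  mE :: "real^'n^'p"
  mF :: "real^'m^'p"
  ylo :: "real^'p"
  yhi :: "real^'p"
  eps :: "real^'p"
  mQ :: "real^'n^'n"
  mR :: "real^'m^'m"
  mTe :: "real^'n^'n"
  mTh :: "real^'n^'n"
  mSe :: "real^'m^'m"
  mSh :: "real^'m^'m"
  horizon :: nat
  freq :: real

text \<open>On vectors, \<open>\<le>\<close> is the componentwise order (but \<open><\<close> is not componentwise).\<close>

definition constraint_set ::
  "('n::finite, 'm::finite, 'p::finite) hmpc \<Rightarrow> ((real^'n) \<times> (real^'m)) set" where
  "constraint_set P = {(x, u). ylo P \<le> mE P *v x + mF P *v u \<and> mE P *v x + mF P *v u \<le> yhi P}"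

record ('n::finite, 'm::finite) harmonic =
  xe :: "real^'n"
  xs :: "real^'n"
  xc :: "real^'n"
  ue :: "real^'m"
  us :: "real^'m"
  uc :: "real^'m"

definition x_harm ::
  "('n::finite, 'm::finite, 'p::finite) hmpc \<Rightarrow> ('n, 'm) harmonic \<Rightarrow> nat \<Rightarrow> real^'n" where
  "x_harm P h j = xe h + sin (freq P * (real j - real (horizon P))) *\<^sub>R xs h
                       + cos (freq P * (real j - real (horizon P))) *\<^sub>R xc h"

definition u_harm ::
  "('n::finite, 'm::finite, 'p::finite) hmpc \<Rightarrow> ('n, 'm) harmonic \<Rightarrow> nat \<Rightarrow> real^'m" where
  "u_harm P h j = ue h + sin (freq P * (real j - real (horizon P))) *\<^sub>R us h
                       + cos (freq P * (real j - real (horizon P))) *\<^sub>R uc h"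

definition harmonic_constraints ::
  "('n::finite, 'm::finite, 'p::finite) hmpc \<Rightarrow> ('n, 'm) harmonic \<Rightarrow> bool" where
  "harmonic_constraints P h \<longleftrightarrow>
     (let ye = mE P *v xe h + mF P *v ue h;
          ys = mE P *v xs h + mF P *v us h;
          yc = mE P *v xc h + mF P *v uc h
      in xe h = mA P *v xe h + mB P *v ue h \<and>
         cos (freq P) *\<^sub>R xs h - sin (freq P) *\<^sub>R xc h = mA P *v xs h + mB P *v us h \<and>
         sin (freq P) *\<^sub>R xs h + cos (freq P) *\<^sub>R xc h = mA P *v xc h + mB P *v uc h \<and>
         (\<forall>i. sqrt ((ys $ i)\<^sup>2 + (yc $ i)\<^sup>2) \<le> ye $ i - ylo P $ i - eps P $ i \<and>
              sqrt ((ys $ i)\<^sup>2 + (yc $ i)\<^sup>2) \<le> yhi P $ i - eps P $ i - ye $ i))"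

definition offset_cost ::
  "('n::finite, 'm::finite, 'p::finite) hmpc \<Rightarrow> real^'n \<Rightarrow> real^'m \<Rightarrow> ('n, 'm) harmonic \<Rightarrow> real"
where
  "offset_cost P xr ur h =
     sq_wnorm (mTe P) (xe h - xr) + sq_wnorm (mSe P) (ue h - ur)
     + sq_wnorm (mTh P) (xs h) + sq_wnorm (mTh P) (xc h)
     + sq_wnorm (mSh P) (us h) + sq_wnorm (mSh P) (uc h)"

text \<open>
  Decision variables. Only \<open>xseq j\<close> for \<open>j \<le> N\<close> and \<open>useq j\<close> for \<open>j < N\<close> are relevant; the
  remaining values enter neither the constraints nor the cost.
\<close>

record ('n::finite, 'm::finite) decision =
  xseq :: "nat \<Rightarrow> real^'n"
  useq :: "nat \<Rightarrow> real^'m"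
  harm :: "('n, 'm) harmonic"

definition hmpc_cost ::
  "('n::finite, 'm::finite, 'p::finite) hmpc \<Rightarrow> real^'n \<Rightarrow> real^'m \<Rightarrow> ('n, 'm) decision \<Rightarrow> real"
where
  "hmpc_cost P xr ur z =
     (\<Sum>j<horizon P. sq_wnorm (mQ P) (xseq z j - x_harm P (harm z) j)
                     + sq_wnorm (mR P) (useq z j - u_harm P (harm z) j))
     + offset_cost P xr ur (harm z)"

definition hmpc_feasible ::
  "('n::finite, 'm::finite, 'p::finite) hmpc \<Rightarrow> real^'n \<Rightarrow> ('n, 'm) decision \<Rightarrow> bool" where
  "hmpc_feasible P x z \<longleftrightarrow>
     (\<forall>j<horizon P. xseq z (Suc j) = mA P *v xseq z j + mB P *v useq z j \<and>
                    (xseq z j, useq z j) \<in> constraint_set P) \<and>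
     xseq z 0 = x \<and>
     xseq z (horizon P) = xe (harm z) + xc (harm z) \<and>
     harmonic_constraints P (harm z)"

definition feasibility_region ::
  "('n::finite, 'm::finite, 'p::finite) hmpc \<Rightarrow> (real^'n) set" where
  "feasibility_region P = {x. \<exists>z. hmpc_feasible P x z}"

definition hmpc_optimal ::
  "('n::finite, 'm::finite, 'p::finite) hmpc \<Rightarrow> real^'n \<Rightarrow> real^'m \<Rightarrow> real^'n
     \<Rightarrow> ('n, 'm) decision \<Rightarrow> bool" where
  "hmpc_optimal P xr ur x z \<longleftrightarrow> is_arg_min (hmpc_cost P xr ur) (hmpc_feasible P x) z"

definition is_optimal_input ::
  "('n::finite, 'm::finite, 'p::finite) hmpc \<Rightarrow> real^'n \<Rightarrow> real^'m \<Rightarrow> real^'n \<Rightarrow> real^'m \<Rightarrow> bool"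
where
  "is_optimal_input P xr ur x v \<longleftrightarrow> (\<exists>z. hmpc_optimal P xr ur x z \<and> useq z 0 = v)"

definition hmpc_law ::
  "('n::finite, 'm::finite, 'p::finite) hmpc \<Rightarrow> real^'n \<Rightarrow> real^'m \<Rightarrow> real^'n \<Rightarrow> real^'m" where
  "hmpc_law P xr ur x = (THE v. is_optimal_input P xr ur x v)"

definition closed_loop ::
  "('n::finite, 'm::finite, 'p::finite) hmpc \<Rightarrow> real^'n \<Rightarrow> real^'m \<Rightarrow> real^'n \<Rightarrow> real^'n" where
  "closed_loop P xr ur x = mA P *v x + mB P *v hmpc_law P xr ur x"

definition state_at ::
  "('n::finite, 'm::finite, 'p::finite) hmpc \<Rightarrow> real^'n \<Rightarrow> real^'m \<Rightarrow> real^'n \<Rightarrow> nat \<Rightarrow> real^'n"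
where
  "state_at P xr ur x0 t = (closed_loop P xr ur ^^ t) x0"

definition input_at ::
  "('n::finite, 'm::finite, 'p::finite) hmpc \<Rightarrow> real^'n \<Rightarrow> real^'m \<Rightarrow> real^'n \<Rightarrow> nat \<Rightarrow> real^'m"
where
  "input_at P xr ur x0 t = hmpc_law P xr ur (state_at P xr ur x0 t)"

definition optimal_harmonic ::
  "('n::finite, 'm::finite, 'p::finite) hmpc \<Rightarrow> real^'n \<Rightarrow> real^'m \<Rightarrow> ('n, 'm) harmonic \<Rightarrow> bool"
where
  "optimal_harmonic P xr ur h \<longleftrightarrow> is_arg_min (offset_cost P xr ur) (harmonic_constraints P) h"

definition admissible_steady_state ::
  "('n::finite, 'm::finite, 'p::finite) hmpc \<Rightarrow> (real^'n) \<times> (real^'m) \<Rightarrow> bool" where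
  "admissible_steady_state P = (\<lambda>(x, u).
     x = mA P *v x + mB P *v u \<and>
     ylo P + eps P \<le> mE P *v x + mF P *v u \<and> mE P *v x + mF P *v u \<le> yhi P - eps P)"

definition optimal_steady_state ::
  "('n::finite, 'm::finite, 'p::finite) hmpc \<Rightarrow> real^'n \<Rightarrow> real^'m \<Rightarrow> (real^'n) \<times> (real^'m) \<Rightarrow> bool"
where
  "optimal_steady_state P xr ur =
     is_arg_min (\<lambda>(x, u). sq_wnorm (mTe P) (x - xr) + sq_wnorm (mSe P) (u - ur))
       (admissible_steady_state P)"

end

theory Submission
  imports Defs
begin

text \<open>
  The proof rests on strong convexity and three constructions of feasible decisions.

  Strong convexity. The costs are sums of positive definite quadratic forms of affine expressions
  in the decision variables, and the constraints are convex and closed. Hence the optimal harmonic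
  reference \<open>h0\<close> exists and is unique, and so do an optimal decision at every feasible state and its
  first input (\<open>midpoint_convex_min_exists\<close>, \<open>optimal_harmonic_unique\<close>, \<open>optimal_input_unique\<close>). The offset
  cost exceeds its minimum by at least a multiple of the squared distance to \<open>h0\<close>
  (\<open>offset_excess_lower\<close>).

  Shifting. Dropping the first step of an optimal decision, continuing along its harmonic reference
  and rotating the parameters of the latter by the base frequency is feasible for the successor
  state and costs less by the first stage cost (\<open>shifted_candidate\<close>). So the feasibility region is
  invariant, the constraints hold, and the first stage cost tends to zero along the closed loop: state
  and input approach the start of the current artificial reference.

  Deadbeat control. Since the horizon is at least the controllability index, a state near the start
  of any admissible harmonic reference can be steered to it within the horizon, at a cost quadratic
  in the distance; the tightening of the constraints makes this admissible (\<open>deadbeat_candidate\<close>). With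
  the reference \<open>h0\<close>, this bounds the optimal value from above near the equilibrium and gives
  Lyapunov stability (\<open>opt_value_lower\<close>, \<open>opt_value_upper\<close>, \<open>closed_loop_stable\<close>).

  Interpolation. With a reference moved slightly from the current one towards \<open>h0\<close>, deadbeat control
  shows that the distance of the current reference from \<open>h0\<close> is at most a multiple of the distance
  of the state from the current reference, once this is small (\<open>harmonic_gap_bound\<close>). The latter tends to zero, so the
  references, the states and the inputs converge.
\<close>

section \<open>Weighted norms and existence of minimizers\<close>

lemma sq_wnorm_zero [simp]: "sq_wnorm M 0 = 0"
  by (simp add: sq_wnorm_def)

lemma sq_wnorm_nonneg: "sym_pos_def M \<Longrightarrow> 0 \<le> sq_wnorm M v"
  unfolding sq_wnorm_def sym_pos_def_def by (cases "v = 0") (auto intro: less_imp_le)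

lemma sq_wnorm_scaleR: "sq_wnorm M (c *\<^sub>R v) = c\<^sup>2 * sq_wnorm M v"
  by (simp add: sq_wnorm_def matrix_vector_mult_scaleR power2_eq_square)

text \<open>The identity behind all strong convexity estimates; \<open>M\<close> is arbitrary.\<close>

lemma sq_wnorm_convex_comb:
  "sq_wnorm M ((1 - l) *\<^sub>R a + l *\<^sub>R b) =
     (1 - l) * sq_wnorm M a + l * sq_wnorm M b - l * (1 - l) * sq_wnorm M (a - b)"
  by (simp add: sq_wnorm_def matrix_vector_mult_scaleR matrix_vector_right_distrib
      matrix_vector_mult_diff_distrib inner_simps algebra_simps)

lemma sq_wnorm_rotate:
  fixes w :: real
  shows "sq_wnorm M (cos w *\<^sub>R a - sin w *\<^sub>R b) + sq_wnorm M (sin w *\<^sub>R a + cos w *\<^sub>R b)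
    = sq_wnorm M a + sq_wnorm M b"
proof -
  have "sq_wnorm M (cos w *\<^sub>R a - sin w *\<^sub>R b) + sq_wnorm M (sin w *\<^sub>R a + cos w *\<^sub>R b)
      = ((sin w)\<^sup>2 + (cos w)\<^sup>2) * sq_wnorm M a + ((sin w)\<^sup>2 + (cos w)\<^sup>2) * sq_wnorm M b"
    by (simp add: sq_wnorm_def matrix_vector_mult_scaleR matrix_vector_right_distrib
        matrix_vector_mult_diff_distrib inner_simps power2_eq_square algebra_simps
        del: sin_cos_squared_add sin_cos_squared_add2 sin_cos_squared_add3)
  then show ?thesis by simp
qed

lemma sq_wnorm_upper:
  obtains C where "0 < C" "\<And>v. sq_wnorm M v \<le> C * (norm v)\<^sup>2"
proof -
  obtain K where K: "0 < K" "\<And>v. norm (M *v v) \<le> norm v * K"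
    using bounded_linear.pos_bounded[OF matrix_vector_mul_bounded_linear] by blast
  have "sq_wnorm M v \<le> K * (norm v)\<^sup>2" for v
  proof -
    have "sq_wnorm M v \<le> norm v * norm (M *v v)"
      unfolding sq_wnorm_def by (rule norm_cauchy_schwarz)
    also have "\<dots> \<le> norm v * (norm v * K)"
      by (intro mult_left_mono K) auto
    finally show ?thesis by (simp add: power2_eq_square mult_ac)
  qed
  with K show ?thesis using that by blast
qed

lemma sq_wnorm_lower:
  fixes M :: "real^'k^'k"
  assumes "sym_pos_def M"
  obtains c where "0 < c" "\<And>v. c * (norm v)\<^sup>2 \<le> sq_wnorm M v"
proof -
  have "continuous_on (sphere 0 1) (sq_wnorm M)"
    unfolding sq_wnorm_def
    by (intro continuous_intros bounded_linear.continuous_on[OF matrix_vector_mul_bounded_linear])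
  moreover have "sphere (0::real^'k) 1 \<noteq> {}" by simp
  ultimately obtain v0 where v0: "v0 \<in> sphere 0 1"
    and min: "\<And>v. v \<in> sphere 0 1 \<Longrightarrow> sq_wnorm M v0 \<le> sq_wnorm M v"
    using continuous_attains_inf[OF compact_sphere] by blast
  have "v0 \<noteq> 0" using v0 by auto
  then have pos: "0 < sq_wnorm M v0"
    using assms by (simp add: sq_wnorm_def sym_pos_def_def)
  have "sq_wnorm M v0 * (norm v)\<^sup>2 \<le> sq_wnorm M v" for v
  proof (cases "v = 0")
    case False
    have "sq_wnorm M v0 \<le> sq_wnorm M ((1 / norm v) *\<^sub>R v)"
      using False by (intro min) simp
    also have "\<dots> = sq_wnorm M v / (norm v)\<^sup>2"
      by (simp add: sq_wnorm_scaleR power_divide)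
    finally show ?thesis using False by (simp add: field_simps)
  qed simp
  with pos show ?thesis using that by blast
qed

lemma matrix_vector_linear_comb:
  fixes M :: "real^'x^'y" and M' :: "real^'z^'y"
  shows "M *v (a *\<^sub>R v + b *\<^sub>R w) + M' *v (a *\<^sub>R v' + b *\<^sub>R w')
    = a *\<^sub>R (M *v v + M' *v v') + b *\<^sub>R (M *v w + M' *v w')"
  by (simp add: matrix_vector_right_distrib matrix_vector_mult_scaleR algebra_simps)

lemma tendsto_matrix_vector_mult [tendsto_intros]:
  "(f \<longlongrightarrow> l) G \<Longrightarrow> ((\<lambda>x. (M::real^'a^'b) *v f x) \<longlongrightarrow> M *v l) G"
  by (rule bounded_linear.tendsto[OF matrix_vector_mul_bounded_linear])

lemma tendsto_sq_wnorm [tendsto_intros]: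
  "(f \<longlongrightarrow> l) G \<Longrightarrow> ((\<lambda>x. sq_wnorm M (f x)) \<longlongrightarrow> sq_wnorm M l) G"
  unfolding sq_wnorm_def by (intro tendsto_intros)

lemma power2_add_le: "(a + b)\<^sup>2 \<le> 2 * a\<^sup>2 + 2 * b\<^sup>2" for a b :: real
  using sum_squares_bound[of a b] by (simp add: power2_sum)

text \<open>
  A nonnegative function that is strongly convex along midpoints, with modulus \<open>D\<close>, attains its
  minimum on \<open>S\<close> as soon as \<open>D\<close>-Cauchy sequences have limits in \<open>S\<close> along which the function
  converges: minimizing sequences are \<open>D\<close>-Cauchy. This replaces compactness, so decisions need not be packed into a Euclidean space whose dimension depends on
  the horizon.
\<close>

lemma midpoint_convex_min_exists:
  fixes J :: "'a \<Rightarrow> real" and D :: "'a \<Rightarrow> 'a \<Rightarrow> real"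
  assumes nonempty: "S a0"
    and nonneg: "\<And>a. S a \<Longrightarrow> 0 \<le> J a"
    and midpoint: "\<And>a b. S a \<Longrightarrow> S b \<Longrightarrow> \<exists>c. S c \<and> J c \<le> (J a + J b) / 2 - D a b / 4"
    and complete: "\<And>s. (\<And>k. S (s k)) \<Longrightarrow>
      (\<And>e. 0 < e \<Longrightarrow> \<exists>M. \<forall>k\<ge>M. \<forall>l\<ge>M. D (s k) (s l) < e) \<Longrightarrow>
      \<exists>a. S a \<and> (\<lambda>k. J (s k)) \<longlonglongrightarrow> J a"
  shows "\<exists>a. is_arg_min J S a"
proof -
  define m where "m = Inf (J ` Collect S)"
  have bdd: "bdd_below (J ` Collect S)"
    using nonneg by (auto intro!: bdd_belowI[of _ 0])
  have lower: "m \<le> J a" if "S a" for a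
    unfolding m_def using that bdd by (auto intro: cInf_lower)
  have "\<exists>a. S a \<and> J a < m + 1 / real (Suc k)" for k
  proof -
    have "Inf (J ` Collect S) < m + 1 / real (Suc k)"
      by (simp add: m_def)
    then show ?thesis
      using cInf_lessD[of "J ` Collect S"] nonempty by blast
  qed
  then obtain s where s: "\<And>k. S (s k)" "\<And>k. J (s k) < m + 1 / real (Suc k)"
    by metis
  have D: "D (s k) (s l) \<le> 2 * (1 / real (Suc k)) + 2 * (1 / real (Suc l))" for k l
  proof -
    obtain c where "S c" and "J c \<le> (J (s k) + J (s l)) / 2 - D (s k) (s l) / 4"
      using midpoint s(1) by blast
    with lower[OF \<open>S c\<close>] s(2)[of k] s(2)[of l] show ?thesis by argo
  qed
  have "\<exists>M. \<forall>k\<ge>M. \<forall>l\<ge>M. D (s k) (s l) < e" if e: "0 < e" for e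
  proof -
    obtain M where M: "1 / real (Suc M) < e / 4"
      using nat_approx_posE[of "e / 4"] e by auto
    have small: "1 / real (Suc k) < e / 4" if "M \<le> k" for k
    proof -
      have "1 / real (Suc k) \<le> 1 / real (Suc M)"
        using that by (intro divide_left_mono) auto
      with M show ?thesis by linarith
    qed
    have "D (s k) (s l) < e" if "M \<le> k" "M \<le> l" for k l
      using small[OF that(1)] small[OF that(2)] D[of k l] by argo
    then show ?thesis by blast
  qed
  with complete s(1) obtain a where a: "S a" "(\<lambda>k. J (s k)) \<longlonglongrightarrow> J a" by blast
  have "(\<lambda>k. m + 1 / real (Suc k)) \<longlonglongrightarrow> m"
    using LIMSEQ_inverse_real_of_nat_add[of m] by (simp add: divide_inverse)
  then have "J a \<le> m"
    by (rule LIMSEQ_le[OF a(2)]) (use s(2) in \<open>auto intro: less_imp_le\<close>)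
  with a lower show ?thesis
    unfolding is_arg_min_linorder by (meson order_trans)
qed

section \<open>Harmonic references\<close>

text \<open>The parameters of a harmonic reference as a point of a Euclidean space.\<close>

definition hvec ::
  "('n::finite, 'm::finite) harmonic \<Rightarrow>
     (real^'n) \<times> (real^'n) \<times> (real^'n) \<times> (real^'m) \<times> (real^'m) \<times> (real^'m)" where
  "hvec h = (xe h, xs h, xc h, ue h, us h, uc h)"

text \<open>The affine combination \<open>(1 - l) h + l k\<close> of two harmonic references.\<close>

definition hcomb ::
  "real \<Rightarrow> ('n::finite, 'm::finite) harmonic \<Rightarrow> ('n, 'm) harmonic \<Rightarrow> ('n, 'm) harmonic" where
  "hcomb l h k =
     \<lparr>xe = (1 - l) *\<^sub>R xe h + l *\<^sub>R xe k, xs = (1 - l) *\<^sub>R xs h + l *\<^sub>R xs k,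
      xc = (1 - l) *\<^sub>R xc h + l *\<^sub>R xc k, ue = (1 - l) *\<^sub>R ue h + l *\<^sub>R ue k,
      us = (1 - l) *\<^sub>R us h + l *\<^sub>R us k, uc = (1 - l) *\<^sub>R uc h + l *\<^sub>R uc k\<rparr>"

text \<open>The componentwise difference of two harmonic references.\<close>

definition hdiff ::
  "('n::finite, 'm::finite) harmonic \<Rightarrow> ('n, 'm) harmonic \<Rightarrow> ('n, 'm) harmonic" where
  "hdiff h k = \<lparr>xe = xe h - xe k, xs = xs h - xs k, xc = xc h - xc k,
                ue = ue h - ue k, us = us h - us k, uc = uc h - uc k\<rparr>"

text \<open>
  The harmonic reference advanced by one sampling time: a rotation by the base frequency of the
  sine and cosine parts, as \<open>x_harm_hshift\<close> below confirms.
\<close>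

definition hshift ::
  "('n::finite, 'm::finite, 'p::finite) hmpc \<Rightarrow> ('n, 'm) harmonic \<Rightarrow> ('n, 'm) harmonic" where
  "hshift P h = \<lparr>xe = xe h,
     xs = cos (freq P) *\<^sub>R xs h - sin (freq P) *\<^sub>R xc h,
     xc = sin (freq P) *\<^sub>R xs h + cos (freq P) *\<^sub>R xc h,
     ue = ue h,
     us = cos (freq P) *\<^sub>R us h - sin (freq P) *\<^sub>R uc h,
     uc = sin (freq P) *\<^sub>R us h + cos (freq P) *\<^sub>R uc h\<rparr>"

lemma hvec_inject: "hvec h = hvec k \<longleftrightarrow> h = k"
  by (auto simp: hvec_def intro: harmonic.equality)

lemma hvec_hdiff: "hvec (hdiff h k) = hvec h - hvec k"
  by (simp add: hvec_def hdiff_def)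

lemma norm_hvec_components:
  "norm (xe h) \<le> norm (hvec h)" "norm (xs h) \<le> norm (hvec h)" "norm (xc h) \<le> norm (hvec h)"
  "norm (ue h) \<le> norm (hvec h)" "norm (us h) \<le> norm (hvec h)" "norm (uc h) \<le> norm (hvec h)"
  by (auto simp: hvec_def norm_Pair intro!: real_le_rsqrt)

lemma tendsto_hvec_components:
  assumes "((\<lambda>k. hvec (f k)) \<longlongrightarrow> hvec h) G"
  shows "((\<lambda>k. xe (f k)) \<longlongrightarrow> xe h) G" "((\<lambda>k. xs (f k)) \<longlongrightarrow> xs h) G"
    "((\<lambda>k. xc (f k)) \<longlongrightarrow> xc h) G" "((\<lambda>k. ue (f k)) \<longlongrightarrow> ue h) G"
    "((\<lambda>k. us (f k)) \<longlongrightarrow> us h) G" "((\<lambda>k. uc (f k)) \<longlongrightarrow> uc h) G"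
proof -
  note s = tendsto_snd
  show "((\<lambda>k. xe (f k)) \<longlongrightarrow> xe h) G" using tendsto_fst[OF assms] by (simp add: hvec_def)
  show "((\<lambda>k. xs (f k)) \<longlongrightarrow> xs h) G" using tendsto_fst[OF s[OF assms]] by (simp add: hvec_def)
  show "((\<lambda>k. xc (f k)) \<longlongrightarrow> xc h) G" using tendsto_fst[OF s[OF s[OF assms]]]
    by (simp add: hvec_def)
  show "((\<lambda>k. ue (f k)) \<longlongrightarrow> ue h) G" using tendsto_fst[OF s[OF s[OF s[OF assms]]]]
    by (simp add: hvec_def)
  show "((\<lambda>k. us (f k)) \<longlongrightarrow> us h) G" using tendsto_fst[OF s[OF s[OF s[OF s[OF assms]]]]]
    by (simp add: hvec_def)
  show "((\<lambda>k. uc (f k)) \<longlongrightarrow> uc h) G" using s[OF s[OF s[OF s[OF s[OF assms]]]]]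
    by (simp add: hvec_def)
qed

lemma x_harm_hdiff: "x_harm P (hdiff h k) j = x_harm P h j - x_harm P k j"
  and u_harm_hdiff: "u_harm P (hdiff h k) j = u_harm P h j - u_harm P k j"
  by (simp_all add: x_harm_def u_harm_def hdiff_def algebra_simps)

lemma x_harm_hcomb: "x_harm P (hcomb l h k) j = (1 - l) *\<^sub>R x_harm P h j + l *\<^sub>R x_harm P k j"
  and u_harm_hcomb: "u_harm P (hcomb l h k) j = (1 - l) *\<^sub>R u_harm P h j + l *\<^sub>R u_harm P k j"
  by (simp_all add: x_harm_def u_harm_def hcomb_def algebra_simps)

lemma norm_sin_cos_comb_le:
  fixes a b c :: "'a::real_normed_vector" and \<theta> :: real
  shows "norm (a + sin \<theta> *\<^sub>R b + cos \<theta> *\<^sub>R c) \<le> norm a + norm b + norm c"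
proof -
  have "norm (sin \<theta> *\<^sub>R b) \<le> norm b" "norm (cos \<theta> *\<^sub>R c) \<le> norm c"
    by (simp_all add: mult_left_le_one_le)
  then show ?thesis
    using norm_triangle_ineq[of "a + sin \<theta> *\<^sub>R b" "cos \<theta> *\<^sub>R c"]
      norm_triangle_ineq[of a "sin \<theta> *\<^sub>R b"] by linarith
qed

lemma norm_x_harm_le: "norm (x_harm P h j) \<le> 3 * norm (hvec h)"
  using norm_sin_cos_comb_le norm_hvec_components[of h] unfolding x_harm_def
  by (smt (verit))

lemma tendsto_harm:
  assumes "((\<lambda>k. hvec (f k)) \<longlongrightarrow> hvec h) G"
  shows "((\<lambda>k. x_harm P (f k) j) \<longlongrightarrow> x_harm P h j) G"
    "((\<lambda>k. u_harm P (f k) j) \<longlongrightarrow> u_harm P h j) G"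
  unfolding x_harm_def u_harm_def
  by (intro tendsto_intros tendsto_hvec_components[OF assms])+

lemma x_harm_horizon [simp]: "x_harm P h (horizon P) = xe h + xc h"
  by (simp add: x_harm_def)

lemma sin_cos_step:
  "sin (freq P * (real (Suc j) - real N)) =
     sin (freq P * (real j - real N)) * cos (freq P) + cos (freq P * (real j - real N)) * sin (freq P)"
  "cos (freq P * (real (Suc j) - real N)) =
     cos (freq P * (real j - real N)) * cos (freq P) - sin (freq P * (real j - real N)) * sin (freq P)"
proof -
  have *: "freq P * (real (Suc j) - real N) = freq P * (real j - real N) + freq P"
    by (simp add: algebra_simps)
  show "sin (freq P * (real (Suc j) - real N)) =
     sin (freq P * (real j - real N)) * cos (freq P) + cos (freq P * (real j - real N)) * sin (freq P)"
    unfolding * by (rule sin_add)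
  show "cos (freq P * (real (Suc j) - real N)) =
     cos (freq P * (real j - real N)) * cos (freq P) - sin (freq P * (real j - real N)) * sin (freq P)"
    unfolding * by (rule cos_add)
qed

lemma x_harm_hshift: "x_harm P (hshift P h) j = x_harm P h (Suc j)"
  and u_harm_hshift: "u_harm P (hshift P h) j = u_harm P h (Suc j)"
  unfolding x_harm_def u_harm_def sin_cos_step by (simp_all add: hshift_def algebra_simps)

lemma harmonic_constraints_iff:
  "harmonic_constraints P h \<longleftrightarrow>
     xe h = mA P *v xe h + mB P *v ue h \<and>
     cos (freq P) *\<^sub>R xs h - sin (freq P) *\<^sub>R xc h = mA P *v xs h + mB P *v us h \<and>
     sin (freq P) *\<^sub>R xs h + cos (freq P) *\<^sub>R xc h = mA P *v xc h + mB P *v uc h \<and>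
     (\<forall>i. sqrt (((mE P *v xs h + mF P *v us h) $ i)\<^sup>2 + ((mE P *v xc h + mF P *v uc h) $ i)\<^sup>2)
            \<le> (mE P *v xe h + mF P *v ue h) $ i - ylo P $ i - eps P $ i \<and>
          sqrt (((mE P *v xs h + mF P *v us h) $ i)\<^sup>2 + ((mE P *v xc h + mF P *v uc h) $ i)\<^sup>2)
            \<le> yhi P $ i - eps P $ i - (mE P *v xe h + mF P *v ue h) $ i)"
  by (simp add: harmonic_constraints_def Let_def)

lemma x_harm_step:
  assumes "harmonic_constraints P h"
  shows "x_harm P h (Suc j) = mA P *v x_harm P h j + mB P *v u_harm P h j"
proof -
  let ?s = "sin (freq P * (real j - real (horizon P)))"
  let ?c = "cos (freq P * (real j - real (horizon P)))"
  have "x_harm P h (Suc j) = xe h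
      + ?s *\<^sub>R (cos (freq P) *\<^sub>R xs h - sin (freq P) *\<^sub>R xc h)
      + ?c *\<^sub>R (sin (freq P) *\<^sub>R xs h + cos (freq P) *\<^sub>R xc h)"
    unfolding x_harm_def sin_cos_step by (simp add: algebra_simps)
  also have "\<dots> = (mA P *v xe h + mB P *v ue h) + ?s *\<^sub>R (mA P *v xs h + mB P *v us h)
      + ?c *\<^sub>R (mA P *v xc h + mB P *v uc h)"
    using assms unfolding harmonic_constraints_iff by metis
  also have "\<dots> = mA P *v x_harm P h j + mB P *v u_harm P h j"
    by (simp add: x_harm_def u_harm_def matrix_vector_right_distrib matrix_vector_mult_scaleR
        algebra_simps)
  finally show ?thesis .
qed

lemma abs_sin_cos_comb_le: "\<bar>sin \<theta> * a + cos \<theta> * b\<bar> \<le> sqrt (a\<^sup>2 + b\<^sup>2)" for \<theta> :: real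
proof (rule real_le_rsqrt)
  have "(sin \<theta> * a + cos \<theta> * b)\<^sup>2 + (cos \<theta> * a - sin \<theta> * b)\<^sup>2
      = ((sin \<theta>)\<^sup>2 + (cos \<theta>)\<^sup>2) * (a\<^sup>2 + b\<^sup>2)"
    by (simp add: power2_eq_square algebra_simps
        del: sin_cos_squared_add sin_cos_squared_add2 sin_cos_squared_add3)
  then have "(sin \<theta> * a + cos \<theta> * b)\<^sup>2 + (cos \<theta> * a - sin \<theta> * b)\<^sup>2 = a\<^sup>2 + b\<^sup>2"
    by simp
  then show "\<bar>sin \<theta> * a + cos \<theta> * b\<bar>\<^sup>2 \<le> a\<^sup>2 + b\<^sup>2"
    unfolding power2_abs using zero_le_power2[of "cos \<theta> * a - sin \<theta> * b"] by linarith
qed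

text \<open>The second-order cone constraints keep the whole reference inside the tightened constraints.\<close>

lemma harm_output_bounds:
  assumes "harmonic_constraints P h"
  shows "ylo P $ i + eps P $ i \<le> (mE P *v x_harm P h j + mF P *v u_harm P h j) $ i"
    and "(mE P *v x_harm P h j + mF P *v u_harm P h j) $ i \<le> yhi P $ i - eps P $ i"
proof -
  let ?\<theta> = "freq P * (real j - real (horizon P))"
  let ?ye = "(mE P *v xe h + mF P *v ue h) $ i"
  let ?ys = "(mE P *v xs h + mF P *v us h) $ i"
  let ?yc = "(mE P *v xc h + mF P *v uc h) $ i"
  have y: "(mE P *v x_harm P h j + mF P *v u_harm P h j) $ i
      = ?ye + (sin ?\<theta> * ?ys + cos ?\<theta> * ?yc)"
    by (simp add: x_harm_def u_harm_def matrix_vector_right_distrib matrix_vector_mult_scaleR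
        algebra_simps)
  have "sqrt (?ys\<^sup>2 + ?yc\<^sup>2) \<le> ?ye - ylo P $ i - eps P $ i"
    "sqrt (?ys\<^sup>2 + ?yc\<^sup>2) \<le> yhi P $ i - eps P $ i - ?ye"
    using assms unfolding harmonic_constraints_iff by blast+
  then show "ylo P $ i + eps P $ i \<le> (mE P *v x_harm P h j + mF P *v u_harm P h j) $ i"
    and "(mE P *v x_harm P h j + mF P *v u_harm P h j) $ i \<le> yhi P $ i - eps P $ i"
    unfolding y using abs_sin_cos_comb_le[of ?\<theta> ?ys ?yc] by linarith+
qed

lemma harmonic_constraints_hshift:
  assumes "harmonic_constraints P h"
  shows "harmonic_constraints P (hshift P h)"
proof -
  let ?s = "sin (freq P)" and ?c = "cos (freq P)"
  note H = assms[unfolded harmonic_constraints_iff]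
  note lin = matrix_vector_linear_comb
  have lin': "M *v (a *\<^sub>R v - b *\<^sub>R w) + M' *v (a *\<^sub>R v' - b *\<^sub>R w')
      = a *\<^sub>R (M *v v + M' *v v') - b *\<^sub>R (M *v w + M' *v w')"
    for a b and M :: "real^'x^'y" and M' :: "real^'z^'y" and v w v' w'
    using lin[of M a v "-b" w M' v' w'] by simp
  have rot: "(?c * a - ?s * b)\<^sup>2 + (?s * a + ?c * b)\<^sup>2 = a\<^sup>2 + b\<^sup>2" for a b
  proof -
    have "(?c * a - ?s * b)\<^sup>2 + (?s * a + ?c * b)\<^sup>2 = (?s\<^sup>2 + ?c\<^sup>2) * (a\<^sup>2 + b\<^sup>2)"
      by (simp add: power2_eq_square algebra_simps
        del: sin_cos_squared_add sin_cos_squared_add2 sin_cos_squared_add3)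
    then show ?thesis by simp
  qed
  have e2: "mA P *v xs h + mB P *v us h = ?c *\<^sub>R xs h - ?s *\<^sub>R xc h"
    and e3: "mA P *v xc h + mB P *v uc h = ?s *\<^sub>R xs h + ?c *\<^sub>R xc h"
    using H by simp_all
  show ?thesis
    unfolding harmonic_constraints_iff
  proof (intro conjI)
    show "xe (hshift P h) = mA P *v xe (hshift P h) + mB P *v ue (hshift P h)"
      using H by (simp only: hshift_def harmonic.simps)
  qed (use H in \<open>simp_all only: hshift_def harmonic.simps lin lin' e2 e3 rot
      vector_minus_component vector_add_component vector_scaleR_component real_scaleR_def simp_thms\<close>)
qed

lemma harmonic_constraints_hcomb:
  assumes h: "harmonic_constraints P h" and k: "harmonic_constraints P k"
    and l: "0 \<le> l" "l \<le> 1"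
  shows "harmonic_constraints P (hcomb l h k)"
proof -
  note H = h[unfolded harmonic_constraints_iff] and K = k[unfolded harmonic_constraints_iff]
  note lin = matrix_vector_linear_comb
  have tri: "sqrt (((1 - l) * a + l * b)\<^sup>2 + ((1 - l) * c + l * d)\<^sup>2)
      \<le> (1 - l) * sqrt (a\<^sup>2 + c\<^sup>2) + l * sqrt (b\<^sup>2 + d\<^sup>2)" for a b c d :: real
  proof -
    have "norm ((1 - l) *\<^sub>R (a, c) + l *\<^sub>R (b, d)) \<le> (1 - l) * norm (a, c) + l * norm (b, d)"
      using l norm_triangle_ineq[of "(1 - l) *\<^sub>R (a, c)" "l *\<^sub>R (b, d)"]
      by (simp only: norm_scaleR)
    then show ?thesis by (simp add: norm_Pair)
  qed
  have mix: "sqrt (((1 - l) * a + l * b)\<^sup>2 + ((1 - l) * c + l * d)\<^sup>2) \<le> (1 - l) * p + l * q"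
    if "sqrt (a\<^sup>2 + c\<^sup>2) \<le> p" "sqrt (b\<^sup>2 + d\<^sup>2) \<le> q" for a b c d p q :: real
  proof -
    have "(1 - l) * sqrt (a\<^sup>2 + c\<^sup>2) + l * sqrt (b\<^sup>2 + d\<^sup>2) \<le> (1 - l) * p + l * q"
      using that l by (intro add_mono mult_left_mono) auto
    with tri[of a b c d] show ?thesis by linarith
  qed
  let ?y = "\<lambda>v w. mE P *v v + mF P *v w"
  have bounds:
    "sqrt (((1 - l) * ?y (xs h) (us h) $ i + l * ?y (xs k) (us k) $ i)\<^sup>2
        + ((1 - l) * ?y (xc h) (uc h) $ i + l * ?y (xc k) (uc k) $ i)\<^sup>2)
      \<le> ((1 - l) * ?y (xe h) (ue h) $ i + l * ?y (xe k) (ue k) $ i) - ylo P $ i - eps P $ i"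
    "sqrt (((1 - l) * ?y (xs h) (us h) $ i + l * ?y (xs k) (us k) $ i)\<^sup>2
        + ((1 - l) * ?y (xc h) (uc h) $ i + l * ?y (xc k) (uc k) $ i)\<^sup>2)
      \<le> yhi P $ i - eps P $ i - ((1 - l) * ?y (xe h) (ue h) $ i + l * ?y (xe k) (ue k) $ i)" for i
  proof -
    have "sqrt ((?y (xs h) (us h) $ i)\<^sup>2 + (?y (xc h) (uc h) $ i)\<^sup>2)
        \<le> ?y (xe h) (ue h) $ i - ylo P $ i - eps P $ i"
      "sqrt ((?y (xs k) (us k) $ i)\<^sup>2 + (?y (xc k) (uc k) $ i)\<^sup>2)
        \<le> ?y (xe k) (ue k) $ i - ylo P $ i - eps P $ i"
      using H K by blast+
    from mix[OF this] show
      "sqrt (((1 - l) * ?y (xs h) (us h) $ i + l * ?y (xs k) (us k) $ i)\<^sup>2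
        + ((1 - l) * ?y (xc h) (uc h) $ i + l * ?y (xc k) (uc k) $ i)\<^sup>2)
      \<le> ((1 - l) * ?y (xe h) (ue h) $ i + l * ?y (xe k) (ue k) $ i) - ylo P $ i - eps P $ i"
      by (simp add: algebra_simps)
    have "sqrt ((?y (xs h) (us h) $ i)\<^sup>2 + (?y (xc h) (uc h) $ i)\<^sup>2)
        \<le> yhi P $ i - eps P $ i - ?y (xe h) (ue h) $ i"
      "sqrt ((?y (xs k) (us k) $ i)\<^sup>2 + (?y (xc k) (uc k) $ i)\<^sup>2)
        \<le> yhi P $ i - eps P $ i - ?y (xe k) (ue k) $ i"
      using H K by blast+
    from mix[OF this] show
      "sqrt (((1 - l) * ?y (xs h) (us h) $ i + l * ?y (xs k) (us k) $ i)\<^sup>2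
        + ((1 - l) * ?y (xc h) (uc h) $ i + l * ?y (xc k) (uc k) $ i)\<^sup>2)
      \<le> yhi P $ i - eps P $ i - ((1 - l) * ?y (xe h) (ue h) $ i + l * ?y (xe k) (ue k) $ i)"
      by (simp add: algebra_simps)
  qed
  have e1: "mA P *v xe h + mB P *v ue h = xe h" "mA P *v xe k + mB P *v ue k = xe k"
    and e2: "mA P *v xs h + mB P *v us h = cos (freq P) *\<^sub>R xs h - sin (freq P) *\<^sub>R xc h"
      "mA P *v xs k + mB P *v us k = cos (freq P) *\<^sub>R xs k - sin (freq P) *\<^sub>R xc k"
    and e3: "mA P *v xc h + mB P *v uc h = sin (freq P) *\<^sub>R xs h + cos (freq P) *\<^sub>R xc h"
      "mA P *v xc k + mB P *v uc k = sin (freq P) *\<^sub>R xs k + cos (freq P) *\<^sub>R xc k"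
    using H K by simp_all
  show ?thesis
    unfolding harmonic_constraints_iff
  proof (intro conjI allI)
    fix i
    show "sqrt (((mE P *v xs (hcomb l h k) + mF P *v us (hcomb l h k)) $ i)\<^sup>2
        + ((mE P *v xc (hcomb l h k) + mF P *v uc (hcomb l h k)) $ i)\<^sup>2)
        \<le> (mE P *v xe (hcomb l h k) + mF P *v ue (hcomb l h k)) $ i - ylo P $ i - eps P $ i"
      "sqrt (((mE P *v xs (hcomb l h k) + mF P *v us (hcomb l h k)) $ i)\<^sup>2
        + ((mE P *v xc (hcomb l h k) + mF P *v uc (hcomb l h k)) $ i)\<^sup>2)
        \<le> yhi P $ i - eps P $ i - (mE P *v xe (hcomb l h k) + mF P *v ue (hcomb l h k)) $ i"
      using bounds[of i]
      by (simp_all only: hcomb_def harmonic.simps lin vector_add_component vector_scaleR_component)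
        simp_all
  qed (simp_all only: hcomb_def harmonic.simps lin e1 e2 e3, simp_all add: algebra_simps)
qed

lemma harmonic_constraints_limit:
  assumes lim: "(\<lambda>k. hvec (f k)) \<longlonglongrightarrow> hvec h" and H: "\<And>k. harmonic_constraints P (f k)"
  shows "harmonic_constraints P h"
proof -
  note t = tendsto_hvec_components[OF lim]
  note H' = H[unfolded harmonic_constraints_iff]
  show ?thesis
    unfolding harmonic_constraints_iff
  proof (intro conjI allI)
    have "(\<lambda>k. xe (f k)) \<longlonglongrightarrow> mA P *v xe h + mB P *v ue h"
      by (subst H'[THEN conjunct1]) (intro tendsto_intros t)
    with t(1) show "xe h = mA P *v xe h + mB P *v ue h" by (rule LIMSEQ_unique)
    have "(\<lambda>k. cos (freq P) *\<^sub>R xs (f k) - sin (freq P) *\<^sub>R xc (f k))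
        \<longlonglongrightarrow> mA P *v xs h + mB P *v us h"
      by (subst H'[THEN conjunct2, THEN conjunct1]) (intro tendsto_intros t)
    moreover have "(\<lambda>k. cos (freq P) *\<^sub>R xs (f k) - sin (freq P) *\<^sub>R xc (f k))
        \<longlonglongrightarrow> cos (freq P) *\<^sub>R xs h - sin (freq P) *\<^sub>R xc h"
      by (intro tendsto_intros t)
    ultimately show "cos (freq P) *\<^sub>R xs h - sin (freq P) *\<^sub>R xc h = mA P *v xs h + mB P *v us h"
      using LIMSEQ_unique by blast
    have "(\<lambda>k. sin (freq P) *\<^sub>R xs (f k) + cos (freq P) *\<^sub>R xc (f k))
        \<longlonglongrightarrow> mA P *v xc h + mB P *v uc h"
      by (subst H'[THEN conjunct2, THEN conjunct2, THEN conjunct1]) (intro tendsto_intros t)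
    moreover have "(\<lambda>k. sin (freq P) *\<^sub>R xs (f k) + cos (freq P) *\<^sub>R xc (f k))
        \<longlonglongrightarrow> sin (freq P) *\<^sub>R xs h + cos (freq P) *\<^sub>R xc h"
      by (intro tendsto_intros t)
    ultimately show "sin (freq P) *\<^sub>R xs h + cos (freq P) *\<^sub>R xc h = mA P *v xc h + mB P *v uc h"
      using LIMSEQ_unique by blast
  next
    fix i
    have lhs: "(\<lambda>k. sqrt (((mE P *v xs (f k) + mF P *v us (f k)) $ i)\<^sup>2
          + ((mE P *v xc (f k) + mF P *v uc (f k)) $ i)\<^sup>2))
        \<longlonglongrightarrow> sqrt (((mE P *v xs h + mF P *v us h) $ i)\<^sup>2 + ((mE P *v xc h + mF P *v uc h) $ i)\<^sup>2)"
      by (intro tendsto_intros t)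
    have lo: "(\<lambda>k. (mE P *v xe (f k) + mF P *v ue (f k)) $ i - ylo P $ i - eps P $ i)
        \<longlonglongrightarrow> (mE P *v xe h + mF P *v ue h) $ i - ylo P $ i - eps P $ i"
      by (intro tendsto_intros t)
    have hi: "(\<lambda>k. yhi P $ i - eps P $ i - (mE P *v xe (f k) + mF P *v ue (f k)) $ i)
        \<longlonglongrightarrow> yhi P $ i - eps P $ i - (mE P *v xe h + mF P *v ue h) $ i"
      by (intro tendsto_intros t)
    show "sqrt (((mE P *v xs h + mF P *v us h) $ i)\<^sup>2 + ((mE P *v xc h + mF P *v uc h) $ i)\<^sup>2)
        \<le> (mE P *v xe h + mF P *v ue h) $ i - ylo P $ i - eps P $ i"
      by (rule LIMSEQ_le[OF lhs lo]) (use H' in blast)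
    show "sqrt (((mE P *v xs h + mF P *v us h) $ i)\<^sup>2 + ((mE P *v xc h + mF P *v uc h) $ i)\<^sup>2)
        \<le> yhi P $ i - eps P $ i - (mE P *v xe h + mF P *v ue h) $ i"
      by (rule LIMSEQ_le[OF lhs hi]) (use H' in blast)
  qed
qed

lemma offset_cost_hshift: "offset_cost P xr ur (hshift P h) = offset_cost P xr ur h"
  using sq_wnorm_rotate[of "mTh P" "freq P" "xs h" "xc h"]
    sq_wnorm_rotate[of "mSh P" "freq P" "us h" "uc h"]
  by (simp add: offset_cost_def hshift_def)

lemma offset_cost_hcomb:
  "offset_cost P xr ur (hcomb l h k) =
     (1 - l) * offset_cost P xr ur h + l * offset_cost P xr ur k
     - l * (1 - l) * offset_cost P 0 0 (hdiff h k)"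
proof -
  have *: "(1 - l) *\<^sub>R a + l *\<^sub>R b - r = (1 - l) *\<^sub>R (a - r) + l *\<^sub>R (b - r)" for a b r :: "real^'x"
    by (simp add: algebra_simps)
  have **: "(a - r) - (b - r) = a - b" for a b r :: "real^'x" by simp
  show ?thesis
    by (simp only: offset_cost_def hcomb_def hdiff_def harmonic.simps * sq_wnorm_convex_comb ** diff_zero)
      (simp add: algebra_simps)
qed

lemma tendsto_offset_cost:
  assumes "((\<lambda>k. hvec (f k)) \<longlongrightarrow> hvec h) G"
  shows "((\<lambda>k. offset_cost P xr ur (f k)) \<longlongrightarrow> offset_cost P xr ur h) G"
  unfolding offset_cost_def by (intro tendsto_intros tendsto_hvec_components[OF assms])

section \<open>Deadbeat control\<close>

lemma lti_state_zero_eq_sum: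
  "lti_state A B 0 u T = (\<Sum>k<T. (((**) A) ^^ k) B *v u (T - 1 - k))"
proof (induction T)
  case (Suc T)
  have "A *v (\<Sum>k<T. (((**) A) ^^ k) B *v u (T - 1 - k))
      = (\<Sum>k<T. A *v ((((**) A) ^^ k) B *v u (T - 1 - k)))"
    by (rule linear_sum[OF matrix_vector_mul_linear])
  then show ?case
    using Suc by (simp add: sum.lessThan_Suc_shift matrix_vector_mul_assoc add.commute
        del: sum.lessThan_Suc)
qed simp

lemma lti_state_split:
  "lti_state A B x u t = lti_state A B x (\<lambda>_. 0) t + lti_state A B 0 u t"
  by (induction t) (simp_all add: matrix_vector_right_distrib algebra_simps)

text \<open>
  The states reachable from the origin in \<open>T\<close> steps are the column space of
  \<open>[B, AB, ..., A^(T-1) B]\<close>.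
\<close>

lemma reachable_eq_span:
  "range (\<lambda>u. lti_state A B 0 u T) = span (\<Union>k<T. columns ((((**) A) ^^ k) B))"
    (is "?R = span ?C")
proof
  show "?R \<subseteq> span ?C"
  proof clarify
    fix u
    have "(((**) A) ^^ k) B *v v \<in> span ?C" if "k < T" for k v
      using matrix_vector_mult_in_columnspace[of "(((**) A) ^^ k) B" v]
        span_mono[of "columns ((((**) A) ^^ k) B)" ?C] that by auto
    then show "lti_state A B 0 u T \<in> span ?C"
      unfolding lti_state_zero_eq_sum by (intro span_sum) auto
  qed
next
  have R: "(\<Sum>k<T. (((**) A) ^^ k) B *v w k) \<in> ?R" for w
  proof -
    have "lti_state A B 0 (\<lambda>j. w (T - 1 - j)) T = (\<Sum>k<T. (((**) A) ^^ k) B *v w k)"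
      unfolding lti_state_zero_eq_sum by (intro sum.cong) auto
    then show ?thesis by (metis rangeI)
  qed
  show "span ?C \<subseteq> ?R"
  proof (rule span_minimal)
    show "?C \<subseteq> ?R"
    proof
      fix c assume "c \<in> ?C"
      then obtain k i where k: "k < T" and c: "c = column i ((((**) A) ^^ k) B)"
        by (auto simp: columns_def)
      have "(\<Sum>l<T. (((**) A) ^^ l) B *v (if l = k then axis i 1 else 0))
          = (\<Sum>l<T. if l = k then (((**) A) ^^ l) B *v axis i 1 else 0)"
        by (intro sum.cong) auto
      also have "\<dots> = (((**) A) ^^ k) B *v axis i 1"
        using k by simp
      also have "\<dots> = c"
        unfolding c by (rule matrix_vector_mult_basis)
      finally have "(\<Sum>l<T. (((**) A) ^^ l) B *v (if l = k then axis i 1 else 0)) = c" .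
      then show "c \<in> ?R"
        using R[of "\<lambda>l. if l = k then axis i 1 else 0"] by (simp only:)
    qed
    show "subspace ?R"
    proof (rule subspaceI)
      show "0 \<in> ?R" using R[of "\<lambda>_. 0"] by simp
    next
      fix x y assume "x \<in> ?R" "y \<in> ?R"
      then obtain u v where "x = lti_state A B 0 u T" "y = lti_state A B 0 v T" by blast
      then have "x + y = (\<Sum>k<T. (((**) A) ^^ k) B *v (u (T - 1 - k) + v (T - 1 - k)))"
        by (simp add: lti_state_zero_eq_sum matrix_vector_right_distrib sum.distrib)
      then show "x + y \<in> ?R"
        using R[of "\<lambda>k. u (T - 1 - k) + v (T - 1 - k)"] by (simp only:)
    next
      fix c x assume "x \<in> ?R"
      then obtain u where "x = lti_state A B 0 u T" by blast
      then have "c *\<^sub>R x = (\<Sum>k<T. (((**) A) ^^ k) B *v (c *\<^sub>R u (T - 1 - k)))"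
        by (simp add: lti_state_zero_eq_sum matrix_vector_mult_scaleR scaleR_sum_right)
      then show "c *\<^sub>R x \<in> ?R"
        using R[of "\<lambda>k. c *\<^sub>R u (T - 1 - k)"] by (simp only:)
    qed
  qed
qed

lemma reachable_UNIV:
  fixes A :: "real^'n^'n" and B :: "real^'m^'n"
  assumes "controllable A B" and "controllability_index A B \<le> N"
  shows "range (\<lambda>u. lti_state A B 0 u N) = UNIV"
proof -
  let ?C = "\<lambda>T. \<Union>k<T. columns ((((**) A) ^^ k) B)"
  have mono: "span (?C S) \<subseteq> span (?C T)" if "S \<le> T" for S T
    using that by (intro span_mono UN_mono) auto
  have full: "ctrb_rank A B T = CARD('n) \<longleftrightarrow> span (?C T) = UNIV" for T
    using dim_eq_full[of "?C T"] by (simp add: ctrb_rank_def)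
  have "\<exists>T u. lti_state A B 0 u T = b" for b
    using assms(1) unfolding controllable_def by blast
  then obtain T u where T: "\<And>b. lti_state A B 0 (u b) (T b) = b" by metis
  define M where "M = Suc (Max (T ` Basis))"
  have "(Basis :: (real^'n) set) \<subseteq> span (?C M)"
  proof
    fix b :: "real^'n" assume "b \<in> Basis"
    then have "T b \<le> M" unfolding M_def by (intro le_SucI Max_ge) auto
    moreover have "b \<in> span (?C (T b))"
      using T[of b] reachable_eq_span[of A B "T b"] by (metis rangeI)
    ultimately show "b \<in> span (?C M)" using mono by blast
  qed
  then have "span (?C M) = UNIV"
    using span_minimal[OF _ subspace_span, of Basis "?C M"] span_Basis by blast
  \<comment> \<open>so the minimum defining the controllability index ranges over a nonempty set\<close>
  then have "0 < M \<and> ctrb_rank A B M = CARD('n)"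
    by (simp add: full M_def)
  then have "ctrb_rank A B (controllability_index A B) = CARD('n)"
    unfolding controllability_index_def by (rule LeastI2) simp
  then have "span (?C N) = UNIV"
    using mono[OF assms(2)] full by auto
  then show ?thesis by (simp add: reachable_eq_span)
qed

text \<open>
  If the horizon is at least the controllability index, any deviation \<open>d\<close> can be steered to the
  origin within the horizon, along states and inputs whose size is linear in \<open>d\<close>. The steering
  inputs of the unit vectors are superposed.
\<close>

lemma deadbeat_control:
  fixes A :: "real^'n^'n" and B :: "real^'m^'n"
  assumes "controllable A B" and "controllability_index A B \<le> N"
  obtains L where "0 < L"
    "\<forall>d. \<exists>\<xi> v. \<xi> 0 = d \<and> \<xi> N = 0 \<and> (\<forall>j. \<xi> (Suc j) = A *v \<xi> j + B *v v j) \<and>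
       (\<forall>j\<le>N. norm (\<xi> j) \<le> L * norm d \<and> norm (v j) \<le> L * norm d)"
proof -
  have "\<exists>u. lti_state A B (axis i 1) u N = 0" for i
  proof -
    have "- lti_state A B (axis i 1) (\<lambda>_. 0) N \<in> range (\<lambda>u. lti_state A B 0 u N)"
      using reachable_UNIV[OF assms] by simp
    then obtain u where "lti_state A B 0 u N = - lti_state A B (axis i 1) (\<lambda>_. 0) N" by auto
    then show ?thesis using lti_state_split[of A B "axis i 1" u N] by auto
  qed
  then obtain V where V: "\<And>i. lti_state A B (axis i 1) (V i) N = 0" by metis
  define X where "X i j = lti_state A B (axis i 1) (V i) j" for i j
  define L where "L = 1 + (\<Sum>j\<le>N. \<Sum>i\<in>UNIV. norm (X i j) + norm (V i j))"
  have L: "0 < L"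
    unfolding L_def by (intro add_pos_nonneg sum_nonneg) auto
  have comb: "norm (\<Sum>i\<in>UNIV. (d $ i) *\<^sub>R f i) \<le> norm d * (\<Sum>i\<in>UNIV. norm (f i))"
    for d :: "real^'n" and f :: "'n \<Rightarrow> real^'k"
  proof -
    have "norm (\<Sum>i\<in>UNIV. (d $ i) *\<^sub>R f i) \<le> (\<Sum>i\<in>UNIV. norm d * norm (f i))"
      by (rule sum_norm_le) (auto intro!: mult_right_mono component_le_norm_cart)
    then show ?thesis by (simp add: sum_distrib_left)
  qed
  have row: "(\<Sum>i\<in>UNIV. norm (X i j) + norm (V i j)) \<le> L" if "j \<le> N" for j
  proof -
    have "(\<Sum>i\<in>UNIV. norm (X i j) + norm (V i j))
        \<le> (\<Sum>j\<le>N. \<Sum>i\<in>UNIV. norm (X i j) + norm (V i j))"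
      using that by (intro member_le_sum) (auto intro: sum_nonneg)
    then show ?thesis by (simp add: L_def)
  qed
  have "\<exists>\<xi> v. \<xi> 0 = d \<and> \<xi> N = 0 \<and> (\<forall>j. \<xi> (Suc j) = A *v \<xi> j + B *v v j) \<and>
       (\<forall>j\<le>N. norm (\<xi> j) \<le> L * norm d \<and> norm (v j) \<le> L * norm d)" for d
  proof -
    define \<xi> where "\<xi> j = (\<Sum>i\<in>UNIV. (d $ i) *\<^sub>R X i j)" for j
    define v where "v j = (\<Sum>i\<in>UNIV. (d $ i) *\<^sub>R V i j)" for j
    have "\<xi> 0 = d"
      using basis_expansion[of d] by (simp add: \<xi>_def X_def scalar_mult_eq_scaleR)
    moreover have "\<xi> N = 0"
      by (simp add: \<xi>_def X_def V)
    moreover have "\<xi> (Suc j) = A *v \<xi> j + B *v v j" for j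
    proof -
      have "A *v \<xi> j = (\<Sum>i\<in>UNIV. (d $ i) *\<^sub>R (A *v X i j))"
        unfolding \<xi>_def by (simp add: linear_sum[OF matrix_vector_mul_linear] matrix_vector_mult_scaleR)
      moreover have "B *v v j = (\<Sum>i\<in>UNIV. (d $ i) *\<^sub>R (B *v V i j))"
        unfolding v_def by (simp add: linear_sum[OF matrix_vector_mul_linear] matrix_vector_mult_scaleR)
      ultimately show ?thesis
        by (simp add: \<xi>_def X_def scaleR_add_right sum.distrib)
    qed
    moreover have "norm (\<xi> j) \<le> L * norm d \<and> norm (v j) \<le> L * norm d" if "j \<le> N" for j
    proof -
      have "(\<Sum>i\<in>UNIV. norm (X i j)) \<le> L" "(\<Sum>i\<in>UNIV. norm (V i j)) \<le> L"
        using row[OF that] sum_nonneg[of UNIV "\<lambda>i. norm (X i j)"]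
          sum_nonneg[of UNIV "\<lambda>i. norm (V i j)"] by (simp_all add: sum.distrib)
      then have "norm d * (\<Sum>i\<in>UNIV. norm (X i j)) \<le> norm d * L"
        "norm d * (\<Sum>i\<in>UNIV. norm (V i j)) \<le> norm d * L"
        by (simp_all add: mult_left_mono)
      with comb[of d "\<lambda>i. X i j"] comb[of d "\<lambda>i. V i j"] show ?thesis
        unfolding \<xi>_def v_def by (simp add: mult.commute)
    qed
    ultimately show ?thesis by blast
  qed
  with L that show ?thesis by blast
qed

section \<open>Decisions\<close>

text \<open>Affine combination and difference of decisions, component by component.\<close>

definition zcomb ::
  "real \<Rightarrow> ('n::finite, 'm::finite) decision \<Rightarrow> ('n, 'm) decision \<Rightarrow> ('n, 'm) decision" where
  "zcomb l z z' =
     \<lparr>xseq = \<lambda>j. (1 - l) *\<^sub>R xseq z j + l *\<^sub>R xseq z' j,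
      useq = \<lambda>j. (1 - l) *\<^sub>R useq z j + l *\<^sub>R useq z' j,
      harm = hcomb l (harm z) (harm z')\<rparr>"

definition zdiff ::
  "('n::finite, 'm::finite) decision \<Rightarrow> ('n, 'm) decision \<Rightarrow> ('n, 'm) decision" where
  "zdiff z z' = \<lparr>xseq = \<lambda>j. xseq z j - xseq z' j, useq = \<lambda>j. useq z j - useq z' j,
                 harm = hdiff (harm z) (harm z')\<rparr>"

text \<open>The summand of the cost that belongs to the prediction time \<open>j\<close>.\<close>

definition stage_cost ::
  "('n::finite, 'm::finite, 'p::finite) hmpc \<Rightarrow> ('n, 'm) decision \<Rightarrow> nat \<Rightarrow> real" where
  "stage_cost P z j = sq_wnorm (mQ P) (xseq z j - x_harm P (harm z) j)
                    + sq_wnorm (mR P) (useq z j - u_harm P (harm z) j)"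

lemma hmpc_cost_eq:
  "hmpc_cost P xr ur z = (\<Sum>j<horizon P. stage_cost P z j) + offset_cost P xr ur (harm z)"
  by (simp add: hmpc_cost_def stage_cost_def)

lemma stage_cost_zcomb:
  "stage_cost P (zcomb l z z') j =
     (1 - l) * stage_cost P z j + l * stage_cost P z' j - l * (1 - l) * stage_cost P (zdiff z z') j"
proof -
  have 1: "(1 - l) *\<^sub>R a + l *\<^sub>R b - ((1 - l) *\<^sub>R c + l *\<^sub>R d) = (1 - l) *\<^sub>R (a - c) + l *\<^sub>R (b - d)"
    and 2: "a - b - (c - d) = a - c - (b - d)" for a b c d :: "real^'x"
    by (simp_all add: algebra_simps)
  have "stage_cost P (zcomb l z z') j
    = sq_wnorm (mQ P) ((1 - l) *\<^sub>R (xseq z j - x_harm P (harm z) j)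
        + l *\<^sub>R (xseq z' j - x_harm P (harm z') j))
    + sq_wnorm (mR P) ((1 - l) *\<^sub>R (useq z j - u_harm P (harm z) j)
        + l *\<^sub>R (useq z' j - u_harm P (harm z') j))"
    by (simp only: stage_cost_def zcomb_def decision.simps x_harm_hcomb u_harm_hcomb 1)
  moreover have "stage_cost P (zdiff z z') j
    = sq_wnorm (mQ P) ((xseq z j - x_harm P (harm z) j) - (xseq z' j - x_harm P (harm z') j))
    + sq_wnorm (mR P) ((useq z j - u_harm P (harm z) j) - (useq z' j - u_harm P (harm z') j))"
    by (simp only: stage_cost_def zdiff_def decision.simps x_harm_hdiff u_harm_hdiff 2)
  ultimately show ?thesis
    by (simp only: sq_wnorm_convex_comb stage_cost_def) (simp add: algebra_simps)
qed

lemma hmpc_cost_zcomb: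
  "hmpc_cost P xr ur (zcomb l z z') =
     (1 - l) * hmpc_cost P xr ur z + l * hmpc_cost P xr ur z'
     - l * (1 - l) * hmpc_cost P 0 0 (zdiff z z')"
proof -
  have 1: "harm (zcomb l z z') = hcomb l (harm z) (harm z')"
    "harm (zdiff z z') = hdiff (harm z) (harm z')"
    by (simp_all add: zcomb_def zdiff_def)
  show ?thesis
    unfolding hmpc_cost_eq 1 offset_cost_hcomb stage_cost_zcomb sum.distrib sum_subtractf
      sum_distrib_left[symmetric]
    by (simp add: algebra_simps)
qed

lemma hmpc_feasible_zcomb:
  assumes z: "hmpc_feasible P x z" and z': "hmpc_feasible P x z'" and l: "0 \<le> l" "l \<le> 1"
  shows "hmpc_feasible P x (zcomb l z z')"
proof -
  note lin = matrix_vector_linear_comb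
  have le: "a \<le> (1 - l) * b + l * c" if "a \<le> b" "a \<le> c" for a b c :: real
    using convex_bound_le[of "-b" "-a" "-c" "1 - l" l] that l by simp
  have ge: "(1 - l) * b + l * c \<le> a" if "b \<le> a" "c \<le> a" for a b c :: real
    using convex_bound_le[of b a c "1 - l" l] that l by simp
  show ?thesis
    unfolding hmpc_feasible_def
  proof (intro conjI allI impI)
    fix j assume j: "j < horizon P"
    then show "xseq (zcomb l z z') (Suc j)
        = mA P *v xseq (zcomb l z z') j + mB P *v useq (zcomb l z z') j"
      using z z' unfolding hmpc_feasible_def by (simp add: zcomb_def lin)
    have "(xseq z j, useq z j) \<in> constraint_set P" "(xseq z' j, useq z' j) \<in> constraint_set P"
      using z z' j unfolding hmpc_feasible_def by blast+
    then show "(xseq (zcomb l z z') j, useq (zcomb l z z') j) \<in> constraint_set P"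
      unfolding constraint_set_def
      by (auto simp: zcomb_def lin less_eq_vec_def intro!: le ge simp del: vector_add_component)
        (simp_all add: le ge)
  next
    show "xseq (zcomb l z z') 0 = x"
      using z z' by (simp add: hmpc_feasible_def zcomb_def algebra_simps)
    show "xseq (zcomb l z z') (horizon P) = xe (harm (zcomb l z z')) + xc (harm (zcomb l z z'))"
      using z z' by (simp add: hmpc_feasible_def zcomb_def hcomb_def algebra_simps)
    show "harmonic_constraints P (harm (zcomb l z z'))"
      using z z' l harmonic_constraints_hcomb by (auto simp: hmpc_feasible_def zcomb_def)
  qed
qed

lemma constraint_set_limit:
  assumes "f \<longlonglongrightarrow> x" "g \<longlonglongrightarrow> u" and "\<And>k. (f k, g k) \<in> constraint_set P"
  shows "(x, u) \<in> constraint_set P"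
proof -
  have lim: "(\<lambda>k. (mE P *v f k + mF P *v g k) $ i) \<longlonglongrightarrow> (mE P *v x + mF P *v u) $ i" for i
    by (intro tendsto_intros assms)
  have "ylo P $ i \<le> (mE P *v x + mF P *v u) $ i" for i
    by (rule LIMSEQ_le_const[OF lim]) (use assms(3) in \<open>auto simp: constraint_set_def less_eq_vec_def\<close>)
  moreover have "(mE P *v x + mF P *v u) $ i \<le> yhi P $ i" for i
    by (rule LIMSEQ_le_const2[OF lim]) (use assms(3) in \<open>auto simp: constraint_set_def less_eq_vec_def\<close>)
  ultimately show ?thesis by (simp add: constraint_set_def less_eq_vec_def)
qed

section \<open>Existence and uniqueness of optima\<close>

lemma convergent_of_sq_bound:
  fixes f :: "nat \<Rightarrow> 'a::banach"
  assumes c: "0 < c" and bound: "\<And>k l. c * (norm (f k - f l))\<^sup>2 \<le> D k l"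
    and D: "\<And>e. 0 < e \<Longrightarrow> \<exists>M. \<forall>k\<ge>M. \<forall>l\<ge>M. D k l < (e::real)"
  shows "convergent f"
proof (rule Cauchy_convergent, rule CauchyI)
  fix e :: real assume e: "0 < e"
  then obtain M where M: "\<And>k l. M \<le> k \<Longrightarrow> M \<le> l \<Longrightarrow> D k l < c * e\<^sup>2"
    using D[of "c * e\<^sup>2"] c by auto
  have "norm (f k - f l) < e" if "M \<le> k" "M \<le> l" for k l
  proof -
    have "c * (norm (f k - f l))\<^sup>2 < c * e\<^sup>2"
      using bound[of k l] M[OF that] by linarith
    then have "(norm (f k - f l))\<^sup>2 < e\<^sup>2" using c by simp
    then show ?thesis using e by (simp add: power_less_imp_less_base)
  qed
  then show "\<exists>M. \<forall>m\<ge>M. \<forall>n\<ge>M. norm (f m - f n) < e" by blast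
qed

text \<open>The standing assumptions on the problem data.\<close>

locale hmpc_setup =
  fixes P :: "('n::finite, 'm::finite, 'p::finite) hmpc"
  assumes ctrb: "controllable (mA P) (mB P)"
    and index_le: "controllability_index (mA P) (mB P) \<le> horizon P"
    and horizon_pos: "0 < horizon P"
    and eps_pos: "\<And>i. 0 < eps P $ i"
    and Q: "sym_pos_def (mQ P)" and R: "sym_pos_def (mR P)"
    and Te: "sym_pos_def (mTe P)" and Th: "sym_pos_def (mTh P)"
    and Se: "sym_pos_def (mSe P)" and Sh: "sym_pos_def (mSh P)"
begin

lemma stage_cost_nonneg: "0 \<le> stage_cost P z j"
  by (simp add: stage_cost_def sq_wnorm_nonneg Q R)

lemma offset_cost_nonneg: "0 \<le> offset_cost P xr ur h"
  by (simp add: offset_cost_def sq_wnorm_nonneg Te Th Se Sh)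

lemma offset_cost_le_hmpc_cost: "offset_cost P xr ur (harm z) \<le> hmpc_cost P xr ur z"
  unfolding hmpc_cost_eq using sum_nonneg[of "{..<horizon P}" "stage_cost P z"] stage_cost_nonneg
  by simp

lemma stage_plus_offset_le_hmpc_cost:
  assumes "j < horizon P"
  shows "stage_cost P z j + offset_cost P xr ur (harm z) \<le> hmpc_cost P xr ur z"
  unfolding hmpc_cost_eq
  using member_le_sum[of j "{..<horizon P}" "stage_cost P z"] stage_cost_nonneg assms by simp

lemma hmpc_cost_nonneg: "0 \<le> hmpc_cost P xr ur z"
  using offset_cost_le_hmpc_cost offset_cost_nonneg by (rule order_trans[rotated])

lemma stage_cost_lower:
  obtains c where "0 < c"
    "\<And>z j. c * (norm (xseq z j - x_harm P (harm z) j))\<^sup>2 \<le> stage_cost P z j"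
    "\<And>z j. c * (norm (useq z j - u_harm P (harm z) j))\<^sup>2 \<le> stage_cost P z j"
proof -
  obtain a where a: "0 < a" "\<And>v. a * (norm v)\<^sup>2 \<le> sq_wnorm (mQ P) v"
    using sq_wnorm_lower[OF Q] by blast
  obtain b where b: "0 < b" "\<And>v. b * (norm v)\<^sup>2 \<le> sq_wnorm (mR P) v"
    using sq_wnorm_lower[OF R] by blast
  have "min a b * (norm v)\<^sup>2 \<le> sq_wnorm (mQ P) v" for v
    using mult_right_mono[of "min a b" a "(norm v)\<^sup>2"] a(2)[of v] by simp
  moreover have "min a b * (norm v)\<^sup>2 \<le> sq_wnorm (mR P) v" for v
    using mult_right_mono[of "min a b" b "(norm v)\<^sup>2"] b(2)[of v] by simp
  ultimately show ?thesis
    using that[of "min a b"] a(1) b(1) sq_wnorm_nonneg[OF Q] sq_wnorm_nonneg[OF R]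
    unfolding stage_cost_def by (simp add: add_increasing add_increasing2)
qed

lemma offset_cost_lower:
  obtains c where "0 < c" "\<And>h. c * (norm (hvec h))\<^sup>2 \<le> offset_cost P 0 0 h"
proof -
  obtain a where a: "0 < a" "\<And>v. a * (norm v)\<^sup>2 \<le> sq_wnorm (mTe P) v"
    using sq_wnorm_lower[OF Te] by blast
  obtain b where b: "0 < b" "\<And>v. b * (norm v)\<^sup>2 \<le> sq_wnorm (mTh P) v"
    using sq_wnorm_lower[OF Th] by blast
  obtain d where d: "0 < d" "\<And>v. d * (norm v)\<^sup>2 \<le> sq_wnorm (mSe P) v"
    using sq_wnorm_lower[OF Se] by blast
  obtain e where e: "0 < e" "\<And>v. e * (norm v)\<^sup>2 \<le> sq_wnorm (mSh P) v"
    using sq_wnorm_lower[OF Sh] by blast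
  define c where "c = min (min a b) (min d e)"
  have c: "0 < c" using a b d e by (simp add: c_def)
  have le: "c * (norm v)\<^sup>2 \<le> sq_wnorm M v"
    if "\<And>v. f * (norm v)\<^sup>2 \<le> sq_wnorm M v" "c \<le> f" for f and M :: "real^'x^'x" and v
    using mult_right_mono[OF that(2), of "(norm v)\<^sup>2"] that(1)[of v] by simp
  have "c * (norm (hvec h))\<^sup>2 \<le> offset_cost P 0 0 h" for h
  proof -
    have "(norm (hvec h))\<^sup>2 = (norm (xe h))\<^sup>2 + ((norm (xs h))\<^sup>2 + ((norm (xc h))\<^sup>2
        + ((norm (ue h))\<^sup>2 + ((norm (us h))\<^sup>2 + (norm (uc h))\<^sup>2))))"
      by (simp add: hvec_def norm_Pair)
    moreover have "c * (norm (xe h))\<^sup>2 \<le> sq_wnorm (mTe P) (xe h)"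
      "c * (norm (xs h))\<^sup>2 \<le> sq_wnorm (mTh P) (xs h)" "c * (norm (xc h))\<^sup>2 \<le> sq_wnorm (mTh P) (xc h)"
      "c * (norm (ue h))\<^sup>2 \<le> sq_wnorm (mSe P) (ue h)"
      "c * (norm (us h))\<^sup>2 \<le> sq_wnorm (mSh P) (us h)" "c * (norm (uc h))\<^sup>2 \<le> sq_wnorm (mSh P) (uc h)"
      by (rule le[OF a(2)] le[OF b(2)] le[OF d(2)] le[OF e(2)]; simp add: c_def)+
    ultimately show ?thesis
      by (simp add: offset_cost_def distrib_left)
  qed
  with c show ?thesis using that by blast
qed

lemma harmonic_Cauchy_limit:
  assumes "\<And>e. 0 < e \<Longrightarrow> \<exists>M. \<forall>k\<ge>M. \<forall>l\<ge>M. offset_cost P 0 0 (hdiff (s k) (s l)) < e"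
  obtains h where "(\<lambda>k. hvec (s k)) \<longlonglongrightarrow> hvec h"
proof -
  obtain c where c: "0 < c" "\<And>h. c * (norm (hvec h))\<^sup>2 \<le> offset_cost P 0 0 h"
    using offset_cost_lower by blast
  have "convergent (\<lambda>k. hvec (s k))"
    using convergent_of_sq_bound[OF c(1) _ assms, where f = "\<lambda>k. hvec (s k)"] c(2)
    by (simp add: hvec_hdiff[symmetric])
  then obtain v where v: "(\<lambda>k. hvec (s k)) \<longlonglongrightarrow> v" by (auto simp: convergent_def)
  obtain a b d e f g where "v = (a, b, d, e, f, g)" by (metis prod.exhaust)
  then have "v = hvec \<lparr>xe = a, xs = b, xc = d, ue = e, us = f, uc = g\<rparr>"
    by (simp add: hvec_def)
  with v that show ?thesis by blast
qed

lemma optimal_harmonic_exists: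
  assumes "harmonic_constraints P h0"
  shows "\<exists>h. optimal_harmonic P xr ur h"
  unfolding optimal_harmonic_def
proof (rule midpoint_convex_min_exists[where D = "\<lambda>h k. offset_cost P 0 0 (hdiff h k)"])
  show "harmonic_constraints P h0" by fact
  show "0 \<le> offset_cost P xr ur h" for h by (rule offset_cost_nonneg)
next
  fix h k assume "harmonic_constraints P h" "harmonic_constraints P k"
  then have "harmonic_constraints P (hcomb (1/2) h k)"
    by (intro harmonic_constraints_hcomb) auto
  moreover have "offset_cost P xr ur (hcomb (1/2) h k)
      \<le> (offset_cost P xr ur h + offset_cost P xr ur k) / 2 - offset_cost P 0 0 (hdiff h k) / 4"
    unfolding offset_cost_hcomb by (simp add: field_simps)
  ultimately show "\<exists>c. harmonic_constraints P c \<and> offset_cost P xr ur c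
      \<le> (offset_cost P xr ur h + offset_cost P xr ur k) / 2 - offset_cost P 0 0 (hdiff h k) / 4"
    by blast
next
  fix s :: "nat \<Rightarrow> ('n, 'm) harmonic"
  assume s: "\<And>k. harmonic_constraints P (s k)"
    and C: "\<And>e. 0 < e \<Longrightarrow> \<exists>M. \<forall>k\<ge>M. \<forall>l\<ge>M. offset_cost P 0 0 (hdiff (s k) (s l)) < e"
  obtain h where h: "(\<lambda>k. hvec (s k)) \<longlonglongrightarrow> hvec h" using harmonic_Cauchy_limit[OF C] .
  show "\<exists>a. harmonic_constraints P a \<and> (\<lambda>k. offset_cost P xr ur (s k)) \<longlonglongrightarrow> offset_cost P xr ur a"
    using harmonic_constraints_limit[OF h s] tendsto_offset_cost[OF h] by blast
qed

text \<open>
  Quadratic growth of the offset cost away from its minimizer (the factor 1/2 comes from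
  comparing with the midpoint only, and suffices).
\<close>

lemma offset_excess_lower:
  assumes opt: "optimal_harmonic P xr ur h0" and h: "harmonic_constraints P h"
  shows "offset_cost P 0 0 (hdiff h h0) / 2 \<le> offset_cost P xr ur h - offset_cost P xr ur h0"
proof -
  have h0: "harmonic_constraints P h0"
    and min: "\<And>k. harmonic_constraints P k \<Longrightarrow> offset_cost P xr ur h0 \<le> offset_cost P xr ur k"
    using opt unfolding optimal_harmonic_def is_arg_min_linorder by blast+
  have "offset_cost P xr ur h0 \<le> offset_cost P xr ur (hcomb (1/2) h h0)"
    by (intro min harmonic_constraints_hcomb h h0) auto
  then show ?thesis unfolding offset_cost_hcomb by (simp add: field_simps)
qed

lemma optimal_harmonic_unique:
  assumes "optimal_harmonic P xr ur h" "optimal_harmonic P xr ur k"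
  shows "h = k"
proof -
  obtain c where c: "0 < c" "\<And>h. c * (norm (hvec h))\<^sup>2 \<le> offset_cost P 0 0 h"
    using offset_cost_lower by blast
  have "harmonic_constraints P h" "offset_cost P xr ur h \<le> offset_cost P xr ur k"
    using assms unfolding optimal_harmonic_def is_arg_min_linorder by blast+
  with offset_excess_lower[OF assms(2), of h] have "offset_cost P 0 0 (hdiff h k) \<le> 0" by simp
  with c(2)[of "hdiff h k"] have "c * (norm (hvec h - hvec k))\<^sup>2 \<le> 0"
    by (simp add: hvec_hdiff)
  with c(1) have "hvec h = hvec k" by (simp add: mult_le_0_iff)
  then show ?thesis by (simp add: hvec_inject)
qed

lemma stage_cost_zdiff_lower:
  obtains c where "0 < c"
    "\<And>z z' j. c * (norm ((xseq z j - x_harm P (harm z) j) - (xseq z' j - x_harm P (harm z') j)))\<^sup>2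
       \<le> stage_cost P (zdiff z z') j"
    "\<And>z z' j. c * (norm ((useq z j - u_harm P (harm z) j) - (useq z' j - u_harm P (harm z') j)))\<^sup>2
       \<le> stage_cost P (zdiff z z') j"
proof -
  obtain c where c: "0 < c"
    "\<And>z j. c * (norm (xseq z j - x_harm P (harm z) j))\<^sup>2 \<le> stage_cost P z j"
    "\<And>z j. c * (norm (useq z j - u_harm P (harm z) j))\<^sup>2 \<le> stage_cost P z j"
    using stage_cost_lower by blast
  have eq: "xseq z j - x_harm P (harm z) j - (xseq z' j - x_harm P (harm z') j)
      = xseq (zdiff z z') j - x_harm P (harm (zdiff z z')) j"
    "useq z j - u_harm P (harm z) j - (useq z' j - u_harm P (harm z') j)
      = useq (zdiff z z') j - u_harm P (harm (zdiff z z')) j" for z z' j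
    by (simp_all add: zdiff_def x_harm_hdiff u_harm_hdiff)
  show ?thesis
    by (rule that[OF c(1)]; unfold eq; rule c)
qed

lemma hmpc_optimal_exists:
  assumes "x \<in> feasibility_region P"
  shows "\<exists>z. hmpc_optimal P xr ur x z"
proof -
  obtain z0 where z0: "hmpc_feasible P x z0"
    using assms by (auto simp: feasibility_region_def)
  obtain c where c: "0 < c"
    "\<And>z z' j. c * (norm ((xseq z j - x_harm P (harm z) j) - (xseq z' j - x_harm P (harm z') j)))\<^sup>2
       \<le> stage_cost P (zdiff z z') j"
    "\<And>z z' j. c * (norm ((useq z j - u_harm P (harm z) j) - (useq z' j - u_harm P (harm z') j)))\<^sup>2
       \<le> stage_cost P (zdiff z z') j"
    using stage_cost_zdiff_lower by blast
  show ?thesis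
    unfolding hmpc_optimal_def
  proof (rule midpoint_convex_min_exists[where D = "\<lambda>z z'. hmpc_cost P 0 0 (zdiff z z')"])
    show "hmpc_feasible P x z0" by fact
    show "0 \<le> hmpc_cost P xr ur z" for z by (rule hmpc_cost_nonneg)
  next
    fix z z' assume "hmpc_feasible P x z" "hmpc_feasible P x z'"
    then have "hmpc_feasible P x (zcomb (1/2) z z')"
      by (intro hmpc_feasible_zcomb) auto
    moreover have "hmpc_cost P xr ur (zcomb (1/2) z z')
        \<le> (hmpc_cost P xr ur z + hmpc_cost P xr ur z') / 2 - hmpc_cost P 0 0 (zdiff z z') / 4"
      unfolding hmpc_cost_zcomb by (simp add: field_simps)
    ultimately show "\<exists>c. hmpc_feasible P x c \<and> hmpc_cost P xr ur c
        \<le> (hmpc_cost P xr ur z + hmpc_cost P xr ur z') / 2 - hmpc_cost P 0 0 (zdiff z z') / 4"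
      by blast
  next
    fix s :: "nat \<Rightarrow> ('n, 'm) decision"
    assume s: "\<And>k. hmpc_feasible P x (s k)"
      and C: "\<And>e. 0 < e \<Longrightarrow> \<exists>M. \<forall>k\<ge>M. \<forall>l\<ge>M. hmpc_cost P 0 0 (zdiff (s k) (s l)) < e"
    have offset_le: "offset_cost P 0 0 (hdiff (harm z) (harm z')) \<le> hmpc_cost P 0 0 (zdiff z z')"
      for z z' :: "('n, 'm) decision"
      using offset_cost_le_hmpc_cost[of 0 0 "zdiff z z'"] by (simp add: zdiff_def)
    have "\<exists>M. \<forall>k\<ge>M. \<forall>l\<ge>M. offset_cost P 0 0 (hdiff (harm (s k)) (harm (s l))) < e"
      if e: "0 < e" for e
    proof -
      obtain M where "\<forall>k\<ge>M. \<forall>l\<ge>M. hmpc_cost P 0 0 (zdiff (s k) (s l)) < e"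
        using C[OF e] by blast
      then show ?thesis
        using order_le_less_trans[OF offset_le] by blast
    qed
    then obtain h where h: "(\<lambda>k. hvec (harm (s k))) \<longlonglongrightarrow> hvec h"
      using harmonic_Cauchy_limit[of "\<lambda>k. harm (s k)"] by blast
    have stage_le: "stage_cost P (zdiff z z') j \<le> hmpc_cost P 0 0 (zdiff z z')"
      if "j < horizon P" for j z z'
      using stage_plus_offset_le_hmpc_cost[OF that, of "zdiff z z'" 0 0]
        offset_cost_nonneg[of 0 0 "harm (zdiff z z')"] by linarith
    define z where "z = \<lparr>xseq = \<lambda>j. lim (\<lambda>k. xseq (s k) j), useq = \<lambda>j. lim (\<lambda>k. useq (s k) j),
      harm = h\<rparr>"
    have hz: "(\<lambda>k. hvec (harm (s k))) \<longlonglongrightarrow> hvec (harm z)"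
      using h by (simp add: z_def)
    have cx: "convergent (\<lambda>k. xseq (s k) j - x_harm P (harm (s k)) j)" if "j < horizon P" for j
      by (rule convergent_of_sq_bound[OF c(1) order_trans[OF c(2) stage_le[OF that]] C])
    have cu: "convergent (\<lambda>k. useq (s k) j - u_harm P (harm (s k)) j)" if "j < horizon P" for j
      by (rule convergent_of_sq_bound[OF c(1) order_trans[OF c(3) stage_le[OF that]] C])
    have chx: "convergent (\<lambda>k. x_harm P (harm (s k)) j)"
      and chu: "convergent (\<lambda>k. u_harm P (harm (s k)) j)" for j
      using tendsto_harm(1)[OF h] tendsto_harm(2)[OF h] by (blast intro: convergentI)+
    have x_lim: "(\<lambda>k. xseq (s k) j) \<longlonglongrightarrow> xseq z j" if "j \<le> horizon P" for j
    proof -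
      have "convergent (\<lambda>k. xseq (s k) j)"
      proof (cases "j < horizon P")
        case True
        from convergent_add[OF cx[OF True] chx[of j]] show ?thesis by simp
      next
        case False
        then have "j = horizon P" using that by simp
        then have "(\<lambda>k. xseq (s k) j) = (\<lambda>k. xe (harm (s k)) + xc (harm (s k)))"
          using s by (simp add: hmpc_feasible_def)
        then show ?thesis
          using tendsto_add[OF tendsto_hvec_components(1,3)[OF h]] by (auto simp: convergent_def)
      qed
      then show ?thesis by (simp add: z_def convergent_LIMSEQ_iff)
    qed
    have u_lim: "(\<lambda>k. useq (s k) j) \<longlonglongrightarrow> useq z j" if "j < horizon P" for j
      using convergent_add[OF cu[OF that] chu[of j]] by (simp add: z_def convergent_LIMSEQ_iff)
    have "hmpc_feasible P x z"
      unfolding hmpc_feasible_def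
    proof (intro conjI allI impI)
      fix j assume j: "j < horizon P"
      have "(\<lambda>k. mA P *v xseq (s k) j + mB P *v useq (s k) j)
          \<longlonglongrightarrow> mA P *v xseq z j + mB P *v useq z j"
        using j by (intro tendsto_intros x_lim u_lim) auto
      moreover have "mA P *v xseq (s k) j + mB P *v useq (s k) j = xseq (s k) (Suc j)" for k
        using s[of k] j by (simp add: hmpc_feasible_def)
      ultimately have "(\<lambda>k. xseq (s k) (Suc j)) \<longlonglongrightarrow> mA P *v xseq z j + mB P *v useq z j"
        by simp
      then show "xseq z (Suc j) = mA P *v xseq z j + mB P *v useq z j"
        using x_lim[of "Suc j"] j by (simp add: LIMSEQ_unique)
      show "(xseq z j, useq z j) \<in> constraint_set P"
        by (rule constraint_set_limit[OF x_lim u_lim]) (use s j in \<open>auto simp: hmpc_feasible_def\<close>)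
    next
      have "xseq (s k) 0 = x" for k using s[of k] by (simp add: hmpc_feasible_def)
      then have "(\<lambda>k. xseq (s k) 0) \<longlonglongrightarrow> x" by simp
      then show "xseq z 0 = x" using x_lim[of 0] by (simp add: LIMSEQ_unique)
      have "xseq (s k) (horizon P) = xe (harm (s k)) + xc (harm (s k))" for k
        using s[of k] by (simp add: hmpc_feasible_def)
      then have "(\<lambda>k. xseq (s k) (horizon P)) \<longlonglongrightarrow> xe (harm z) + xc (harm z)"
        using tendsto_add[OF tendsto_hvec_components(1,3)[OF hz]] by simp
      then show "xseq z (horizon P) = xe (harm z) + xc (harm z)"
        using x_lim[of "horizon P"] by (simp add: LIMSEQ_unique)
      show "harmonic_constraints P (harm z)"
        by (rule harmonic_constraints_limit[OF hz]) (use s in \<open>auto simp: hmpc_feasible_def\<close>)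
    qed
    moreover have "(\<lambda>k. hmpc_cost P xr ur (s k)) \<longlonglongrightarrow> hmpc_cost P xr ur z"
      unfolding hmpc_cost_def
      by (intro tendsto_intros tendsto_harm[OF hz] x_lim u_lim tendsto_offset_cost[OF hz]) auto
    ultimately show "\<exists>a. hmpc_feasible P x a \<and>
        (\<lambda>k. hmpc_cost P xr ur (s k)) \<longlonglongrightarrow> hmpc_cost P xr ur a" by blast
  qed
qed

text \<open>
  Optimal decisions are unique only up to the entries of their sequences beyond the horizon; as
  the horizon is positive, the first input is determined.
\<close>

lemma optimal_input_unique:
  assumes z: "hmpc_optimal P xr ur x z" and z': "hmpc_optimal P xr ur x z'"
  shows "useq z 0 = useq z' 0"
proof -
  have f: "hmpc_feasible P x z" "hmpc_feasible P x z'"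
    and eq: "hmpc_cost P xr ur z = hmpc_cost P xr ur z'"
    and min: "\<And>y. hmpc_feasible P x y \<Longrightarrow> hmpc_cost P xr ur z \<le> hmpc_cost P xr ur y"
    using z z' unfolding hmpc_optimal_def is_arg_min_linorder by (auto intro: antisym)
  have "hmpc_cost P xr ur z \<le> hmpc_cost P xr ur (zcomb (1/2) z z')"
    by (intro min hmpc_feasible_zcomb f) auto
  then have D: "hmpc_cost P 0 0 (zdiff z z') \<le> 0"
    unfolding hmpc_cost_zcomb eq by (simp add: field_simps)
  obtain c where c: "0 < c"
    "\<And>z z' j. c * (norm ((useq z j - u_harm P (harm z) j) - (useq z' j - u_harm P (harm z') j)))\<^sup>2
       \<le> stage_cost P (zdiff z z') j"
    using stage_cost_zdiff_lower by metis
  obtain a where a: "0 < a" "\<And>h. a * (norm (hvec h))\<^sup>2 \<le> offset_cost P 0 0 h"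
    using offset_cost_lower by blast
  have le: "stage_cost P (zdiff z z') 0 \<le> 0" "offset_cost P 0 0 (harm (zdiff z z')) \<le> 0"
    using D stage_plus_offset_le_hmpc_cost[OF horizon_pos, of "zdiff z z'" 0 0]
      stage_cost_nonneg[of "zdiff z z'" 0] offset_cost_nonneg[of 0 0 "harm (zdiff z z')"] by linarith+
  have "a * (norm (hvec (harm z) - hvec (harm z')))\<^sup>2 \<le> 0"
    using le(2) a(2)[of "harm (zdiff z z')"] by (simp add: zdiff_def hvec_hdiff)
  then have "harm z = harm z'"
    using a(1) by (simp add: mult_le_0_iff hvec_inject)
  moreover have "c * (norm ((useq z 0 - u_harm P (harm z) 0) - (useq z' 0 - u_harm P (harm z') 0)))\<^sup>2 \<le> 0"
    using le(1) c(2)[of z 0 z'] by linarith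
  ultimately show ?thesis using c(1) by (simp add: mult_le_0_iff)
qed

section \<open>Feasible candidates\<close>

text \<open>
  Recursive feasibility and decrease of the cost: drop the first step, append one step along the
  harmonic reference, on which the prediction ends, and advance the reference by one sampling
  time. The stage costs are shifted, the new last one vanishes and the offset cost is unchanged.
\<close>

lemma shifted_candidate:
  assumes z: "hmpc_feasible P x z"
  shows "\<exists>z'. hmpc_feasible P (mA P *v x + mB P *v useq z 0) z' \<and>
    hmpc_cost P xr ur z' = hmpc_cost P xr ur z - stage_cost P z 0"
proof -
  obtain M where N: "horizon P = Suc M" using horizon_pos by (cases "horizon P") auto
  let ?h = "harm z"
  have dyn: "\<And>j. j < horizon P \<Longrightarrow> xseq z (Suc j) = mA P *v xseq z j + mB P *v useq z j"
    and con: "\<And>j. j < horizon P \<Longrightarrow> (xseq z j, useq z j) \<in> constraint_set P"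
    and x0: "xseq z 0 = x" and xN: "xseq z (horizon P) = x_harm P ?h (horizon P)"
    and H: "harmonic_constraints P ?h"
    using z by (auto simp: hmpc_feasible_def)
  define z' where "z' = \<lparr>
    xseq = \<lambda>j. if j < horizon P then xseq z (Suc j) else x_harm P ?h (Suc j),
    useq = \<lambda>j. if j < M then useq z (Suc j) else u_harm P ?h (Suc j),
    harm = hshift P ?h\<rparr>"
  have "hmpc_feasible P (mA P *v x + mB P *v useq z 0) z'"
    unfolding hmpc_feasible_def
  proof (intro conjI allI impI)
    fix j assume j: "j < horizon P"
    show "xseq z' (Suc j) = mA P *v xseq z' j + mB P *v useq z' j"
    proof (cases "j < M")
      case True
      then show ?thesis using dyn[of "Suc j"] by (simp add: z'_def N)
    next
      case False
      with j have "j = M" by (simp add: N)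
      then show ?thesis using xN x_harm_step[OF H, of "Suc M"] by (simp add: z'_def N)
    qed
    show "(xseq z' j, useq z' j) \<in> constraint_set P"
    proof (cases "j < M")
      case True
      then show ?thesis using con[of "Suc j"] by (simp add: z'_def N)
    next
      case False
      with j have "j = M" by (simp add: N)
      then have "xseq z' j = x_harm P ?h (Suc M)" "useq z' j = u_harm P ?h (Suc M)"
        using xN by (simp_all add: z'_def N)
      moreover have "ylo P $ i \<le> (mE P *v x_harm P ?h k + mF P *v u_harm P ?h k) $ i"
        "(mE P *v x_harm P ?h k + mF P *v u_harm P ?h k) $ i \<le> yhi P $ i" for i k
        using harm_output_bounds[OF H, where i = i and j = k] eps_pos[of i] by linarith+
      ultimately show ?thesis by (simp add: constraint_set_def less_eq_vec_def)
    qed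
  next
    show "xseq z' 0 = mA P *v x + mB P *v useq z 0"
      using dyn[of 0] x0 by (simp add: z'_def N)
    have "x_harm P ?h (Suc (horizon P)) = x_harm P (hshift P ?h) (horizon P)"
      by (simp only: x_harm_hshift)
    then show "xseq z' (horizon P) = xe (harm z') + xc (harm z')"
      by (simp add: z'_def)
    show "harmonic_constraints P (harm z')"
      using harmonic_constraints_hshift[OF H] by (simp add: z'_def)
  qed
  moreover have "hmpc_cost P xr ur z' = hmpc_cost P xr ur z - stage_cost P z 0"
  proof -
    have "stage_cost P z' j = stage_cost P z (Suc j)" if "j < M" for j
      using that by (simp add: stage_cost_def z'_def N x_harm_hshift u_harm_hshift)
    moreover have "stage_cost P z' M = 0"
      using xN by (simp add: stage_cost_def z'_def N x_harm_hshift u_harm_hshift)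
    ultimately have "(\<Sum>j<horizon P. stage_cost P z' j) = (\<Sum>j<M. stage_cost P z (Suc j))"
      by (simp add: N)
    also have "\<dots> = (\<Sum>j<horizon P. stage_cost P z j) - stage_cost P z 0"
      by (simp add: N sum.lessThan_Suc_shift del: sum.lessThan_Suc)
    finally show ?thesis
      by (simp add: hmpc_cost_eq) (simp add: z'_def offset_cost_hshift)
  qed
  ultimately show ?thesis by blast
qed

text \<open>
  A state close enough to the start of an admissible harmonic reference \<open>h\<close> admits a feasible decision
  with this reference: superpose a deadbeat trajectory on it. The tightening \<open>eps\<close> leaves room
  for the deviation in the constraints, and makes the radius \<open>\<rho>\<close> independent of \<open>h\<close>.
\<close>

lemma deadbeat_candidate:
  obtains \<rho> C where "0 < \<rho>" "0 < C"
    "\<And>xr ur h x. harmonic_constraints P h \<Longrightarrow> norm (x - x_harm P h 0) \<le> \<rho> \<Longrightarrow>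
       \<exists>z. hmpc_feasible P x z \<and> harm z = h \<and>
           hmpc_cost P xr ur z \<le> offset_cost P xr ur h + C * (norm (x - x_harm P h 0))\<^sup>2"
proof -
  obtain L where L: "0 < L" and dead:
    "\<forall>d. \<exists>\<xi> v. \<xi> 0 = d \<and> \<xi> (horizon P) = 0 \<and>
       (\<forall>j. \<xi> (Suc j) = mA P *v \<xi> j + mB P *v v j) \<and>
       (\<forall>j\<le>horizon P. norm (\<xi> j) \<le> L * norm d \<and> norm (v j) \<le> L * norm d)"
    by (rule deadbeat_control[OF ctrb index_le])
  obtain KE where KE: "0 < KE" "\<And>v. norm (mE P *v v) \<le> norm v * KE"
    using bounded_linear.pos_bounded[OF matrix_vector_mul_bounded_linear] by blast
  obtain KF where KF: "0 < KF" "\<And>v. norm (mF P *v v) \<le> norm v * KF"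
    using bounded_linear.pos_bounded[OF matrix_vector_mul_bounded_linear] by blast
  obtain CQ where CQ: "0 < CQ" "\<And>v. sq_wnorm (mQ P) v \<le> CQ * (norm v)\<^sup>2"
    using sq_wnorm_upper by blast
  obtain CR where CR: "0 < CR" "\<And>v. sq_wnorm (mR P) v \<le> CR * (norm v)\<^sup>2"
    using sq_wnorm_upper by blast
  define \<epsilon> where "\<epsilon> = Min (range (\<lambda>i. eps P $ i))"
  have \<epsilon>: "0 < \<epsilon>" "\<And>i. \<epsilon> \<le> eps P $ i"
    using eps_pos by (auto simp: \<epsilon>_def Min_gr_iff)
  define \<rho> where "\<rho> = \<epsilon> / (L * (KE + KF))"
  define C where "C = real (horizon P) * ((CQ + CR) * L\<^sup>2)"
  have pos: "0 < \<rho>" "0 < C"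
    using \<epsilon> L KE KF CQ CR horizon_pos by (simp_all add: \<rho>_def C_def add_pos_pos)
  have "\<exists>z. hmpc_feasible P x z \<and> harm z = h \<and>
      hmpc_cost P xr ur z \<le> offset_cost P xr ur h + C * (norm (x - x_harm P h 0))\<^sup>2"
    if H: "harmonic_constraints P h" and near: "norm (x - x_harm P h 0) \<le> \<rho>" for xr ur h x
  proof -
    define d where "d = x - x_harm P h 0"
    obtain \<xi> v where \<xi>: "\<xi> 0 = d" "\<xi> (horizon P) = 0"
      "\<And>j. \<xi> (Suc j) = mA P *v \<xi> j + mB P *v v j"
      and bd: "\<And>j. j \<le> horizon P \<Longrightarrow> norm (\<xi> j) \<le> L * norm d"
      "\<And>j. j \<le> horizon P \<Longrightarrow> norm (v j) \<le> L * norm d"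
      using dead[rule_format, of d] by blast
    define z where "z = \<lparr>xseq = \<lambda>j. x_harm P h j + \<xi> j, useq = \<lambda>j. u_harm P h j + v j, harm = h\<rparr>"
    have out: "\<bar>(mE P *v \<xi> j + mF P *v v j) $ i\<bar> \<le> eps P $ i" if "j \<le> horizon P" for i j
    proof -
      have "\<bar>(mE P *v \<xi> j + mF P *v v j) $ i\<bar> \<le> norm (mE P *v \<xi> j + mF P *v v j)"
        by (rule component_le_norm_cart)
      also have "\<dots> \<le> norm (\<xi> j) * KE + norm (v j) * KF"
        using KE(2)[of "\<xi> j"] KF(2)[of "v j"] norm_triangle_ineq[of "mE P *v \<xi> j" "mF P *v v j"]
        by linarith
      also have "\<dots> \<le> (L * norm d) * KE + (L * norm d) * KF"
        using bd[OF that] KE KF by (intro add_mono mult_right_mono) auto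
      also have "\<dots> = (L * (KE + KF)) * norm d" by (simp add: algebra_simps)
      also have "\<dots> \<le> (L * (KE + KF)) * \<rho>"
        using near L KE KF by (intro mult_left_mono) (auto simp: d_def)
      also have "\<dots> = \<epsilon>" using L KE KF by (simp add: \<rho>_def)
      finally show ?thesis using \<epsilon>(2)[of i] by linarith
    qed
    have "hmpc_feasible P x z"
      unfolding hmpc_feasible_def
    proof (intro conjI allI impI)
      fix j assume j: "j < horizon P"
      show "xseq z (Suc j) = mA P *v xseq z j + mB P *v useq z j"
        by (simp add: z_def x_harm_step[OF H] \<xi>(3) matrix_vector_right_distrib algebra_simps)
      have "mE P *v xseq z j + mF P *v useq z j
          = (mE P *v x_harm P h j + mF P *v u_harm P h j) + (mE P *v \<xi> j + mF P *v v j)"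
        by (simp add: z_def matrix_vector_right_distrib algebra_simps)
      then have y: "(mE P *v xseq z j + mF P *v useq z j) $ i
          = (mE P *v x_harm P h j + mF P *v u_harm P h j) $ i + (mE P *v \<xi> j + mF P *v v j) $ i" for i
        by (simp only: vector_add_component)
      have "ylo P $ i \<le> (mE P *v xseq z j + mF P *v useq z j) $ i"
        "(mE P *v xseq z j + mF P *v useq z j) $ i \<le> yhi P $ i" for i
        unfolding y using out[of j i] j harm_output_bounds[OF H, where i = i and j = j] by linarith+
      then show "(xseq z j, useq z j) \<in> constraint_set P"
        by (simp add: constraint_set_def less_eq_vec_def)
    next
      show "xseq z 0 = x" by (simp add: z_def \<xi> d_def)
      show "xseq z (horizon P) = xe (harm z) + xc (harm z)" by (simp add: z_def \<xi>)
      show "harmonic_constraints P (harm z)" using H by (simp add: z_def)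
    qed
    moreover have "hmpc_cost P xr ur z \<le> offset_cost P xr ur h + C * (norm d)\<^sup>2"
    proof -
      have "stage_cost P z j \<le> (CQ + CR) * L\<^sup>2 * (norm d)\<^sup>2" if "j < horizon P" for j
      proof -
        have "stage_cost P z j \<le> CQ * (norm (\<xi> j))\<^sup>2 + CR * (norm (v j))\<^sup>2"
          using CQ(2)[of "\<xi> j"] CR(2)[of "v j"] by (simp add: stage_cost_def z_def)
        also have "\<dots> \<le> CQ * (L * norm d)\<^sup>2 + CR * (L * norm d)\<^sup>2"
          using bd[of j] that CQ(1) CR(1) by (intro add_mono mult_left_mono power_mono) auto
        finally show ?thesis by (simp add: power_mult_distrib algebra_simps)
      qed
      then have "(\<Sum>j<horizon P. stage_cost P z j) \<le> real (horizon P) * ((CQ + CR) * L\<^sup>2 * (norm d)\<^sup>2)"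
        using sum_bounded_above[of "{..<horizon P}" "stage_cost P z"] by simp
      then show ?thesis by (simp add: hmpc_cost_eq C_def z_def mult_ac)
    qed
    ultimately show ?thesis by (auto simp: z_def d_def)
  qed
  with pos that show ?thesis by blast
qed

end

section \<open>The closed loop\<close>

context hmpc_setup
begin

text \<open>
  Some optimal decision, and the optimal value, at a state; meaningful on the feasibility region
  only, where an optimum exists.
\<close>

definition opt_decision :: "real^'n \<Rightarrow> real^'m \<Rightarrow> real^'n \<Rightarrow> ('n, 'm) decision" where
  "opt_decision xr ur x = (SOME z. hmpc_optimal P xr ur x z)"

definition opt_value :: "real^'n \<Rightarrow> real^'m \<Rightarrow> real^'n \<Rightarrow> real" where
  "opt_value xr ur x = hmpc_cost P xr ur (opt_decision xr ur x)"

context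
  fixes xr :: "real^'n" and ur :: "real^'m"
begin

text \<open>Short names for a fixed reference \<open>(xr, ur)\<close>.\<close>

abbreviation "X \<equiv> feasibility_region P"
abbreviation "zo \<equiv> opt_decision xr ur"
abbreviation "val \<equiv> opt_value xr ur"
abbreviation "step \<equiv> closed_loop P xr ur"
abbreviation "off \<equiv> offset_cost P xr ur"

lemma opt_decision_optimal: "x \<in> X \<Longrightarrow> hmpc_optimal P xr ur x (zo x)"
  unfolding opt_decision_def by (rule someI_ex) (rule hmpc_optimal_exists)

lemma opt_decision_feasible: "x \<in> X \<Longrightarrow> hmpc_feasible P x (zo x)"
  using opt_decision_optimal unfolding hmpc_optimal_def is_arg_min_def by blast

lemma opt_value_le: "hmpc_feasible P x z \<Longrightarrow> val x \<le> hmpc_cost P xr ur z"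
  using opt_decision_optimal[of x]
  unfolding hmpc_optimal_def is_arg_min_linorder opt_value_def feasibility_region_def by blast

lemma is_optimal_input_iff:
  assumes "x \<in> X"
  shows "is_optimal_input P xr ur x v \<longleftrightarrow> v = useq (zo x) 0"
  using opt_decision_optimal[OF assms] optimal_input_unique unfolding is_optimal_input_def by blast

lemma hmpc_law_eq: "x \<in> X \<Longrightarrow> hmpc_law P xr ur x = useq (zo x) 0"
  unfolding hmpc_law_def by (rule the_equality) (simp_all add: is_optimal_input_iff)

lemma hmpc_law_admissible: "x \<in> X \<Longrightarrow> (x, hmpc_law P xr ur x) \<in> constraint_set P"
  using opt_decision_feasible[of x] horizon_pos unfolding hmpc_feasible_def
  by (metis hmpc_law_eq)

lemma closed_loop_decrease:
  assumes "x \<in> X"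
  shows "step x \<in> X" "val (step x) \<le> val x - stage_cost P (zo x) 0"
proof -
  obtain z where z: "hmpc_feasible P (step x) z"
    "hmpc_cost P xr ur z = hmpc_cost P xr ur (zo x) - stage_cost P (zo x) 0"
    using shifted_candidate[OF opt_decision_feasible[OF assms], of xr ur]
    unfolding closed_loop_def hmpc_law_eq[OF assms] by blast
  show "step x \<in> X" using z(1) by (auto simp: feasibility_region_def)
  show "val (step x) \<le> val x - stage_cost P (zo x) 0"
    using opt_value_le[OF z(1)] z(2) by (simp add: opt_value_def)
qed

lemma state_at_feasible: "x \<in> X \<Longrightarrow> state_at P xr ur x t \<in> X"
  unfolding state_at_def by (induction t) (auto intro: closed_loop_decrease)

lemma opt_value_antimono: "x \<in> X \<Longrightarrow> val (state_at P xr ur x t) \<le> val x"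
proof (induction t)
  case (Suc t)
  then show ?case
    using closed_loop_decrease(2)[OF state_at_feasible[OF Suc.prems, of t]]
      stage_cost_nonneg[of "zo (state_at P xr ur x t)" 0] by (simp add: state_at_def)
qed (simp add: state_at_def)

lemma opt_value_ge: "stage_cost P (zo x) 0 + off (harm (zo x)) \<le> val x"
  unfolding opt_value_def by (rule stage_plus_offset_le_hmpc_cost[OF horizon_pos])

text \<open>The first stage costs are dominated by the decrements of the convergent optimal value.\<close>

lemma stage_cost_tendsto_zero:
  assumes "x \<in> X"
  shows "(\<lambda>t. stage_cost P (zo (state_at P xr ur x t)) 0) \<longlonglongrightarrow> 0"
proof -
  let ?x = "state_at P xr ur x"
  have step: "val (?x (Suc t)) \<le> val (?x t) - stage_cost P (zo (?x t)) 0" for t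
    using closed_loop_decrease(2)[OF state_at_feasible[OF assms, of t]] by (simp add: state_at_def)
  have "decseq (\<lambda>t. val (?x t))"
    by (rule decseq_SucI) (use step stage_cost_nonneg in \<open>smt (verit)\<close>)
  moreover have "0 \<le> val (?x t)" for t
    unfolding opt_value_def by (rule hmpc_cost_nonneg)
  ultimately obtain l where l: "(\<lambda>t. val (?x t)) \<longlonglongrightarrow> l"
    using decseq_convergent by metis
  have "(\<lambda>t. val (?x t) - val (?x (Suc t))) \<longlonglongrightarrow> l - l"
    by (intro tendsto_diff l LIMSEQ_Suc[OF l])
  then have lim: "(\<lambda>t. val (?x t) - val (?x (Suc t))) \<longlonglongrightarrow> 0" by simp
  show ?thesis
  proof (rule tendsto_sandwich[OF _ _ tendsto_const lim])
    show "\<forall>\<^sub>F t in sequentially. 0 \<le> stage_cost P (zo (?x t)) 0"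
      by (simp add: stage_cost_nonneg)
    have "stage_cost P (zo (?x t)) 0 \<le> val (?x t) - val (?x (Suc t))" for t
      using step[of t] by linarith
    then show "\<forall>\<^sub>F t in sequentially.
        stage_cost P (zo (?x t)) 0 \<le> val (?x t) - val (?x (Suc t))"
      by simp
  qed
qed

text \<open>
  The step that identifies the limit. Let \<open>h\<close> be the harmonic reference chosen at \<open>x\<close> and \<open>d\<close> the
  distance of \<open>x\<close> from its start. Moving \<open>h\<close> by a small fraction \<open>l\<close> towards the optimal reference
  \<open>h0\<close> saves offset cost of order \<open>l g^2\<close>, where \<open>g\<close> is the distance of \<open>h\<close> from \<open>h0\<close>, whereas steering
  \<open>x\<close> to the moved reference costs at most of order \<open>(d + l g)^2\<close>. By optimality of \<open>h\<close> the saving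
  cannot exceed the cost, so that for small \<open>l\<close> the gap \<open>g\<close> is bounded by a multiple of \<open>d\<close>.
  The fraction \<open>l\<close> depends on the bound \<open>V\<close> of the optimal value, which bounds \<open>g\<close>.
\<close>

lemma harmonic_gap_bound:
  assumes opt: "optimal_harmonic P xr ur h0"
  obtains \<delta> K where "0 < \<delta>" "0 < K"
    "\<And>x. x \<in> X \<Longrightarrow> val x \<le> V \<Longrightarrow> norm (x - x_harm P (harm (zo x)) 0) \<le> \<delta> \<Longrightarrow>
       (norm (hvec (harm (zo x)) - hvec h0))\<^sup>2 \<le> K * (norm (x - x_harm P (harm (zo x)) 0))\<^sup>2"
proof -
  obtain \<rho> C where \<rho>: "0 < \<rho>" and C: "0 < C" and cand:
    "\<And>xr ur h x. harmonic_constraints P h \<Longrightarrow> norm (x - x_harm P h 0) \<le> \<rho> \<Longrightarrow>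
       \<exists>z. hmpc_feasible P x z \<and> harm z = h \<and>
           hmpc_cost P xr ur z \<le> offset_cost P xr ur h + C * (norm (x - x_harm P h 0))\<^sup>2"
    using deadbeat_candidate by blast
  obtain c where c: "0 < c" "\<And>h. c * (norm (hvec h))\<^sup>2 \<le> offset_cost P 0 0 h"
    using offset_cost_lower by blast
  have h0: "harmonic_constraints P h0"
    using opt unfolding optimal_harmonic_def is_arg_min_linorder by blast
  \<comment> \<open>a bound on the distance of the references; the summand 1 only makes it positive\<close>
  define G where "G = sqrt (2 * \<bar>V\<bar> / c) + 1"
  have G: "0 < G" unfolding G_def using c by (intro add_nonneg_pos) auto
  \<comment> \<open>the second bound makes the quadratic term in \<open>l\<close> half of the saving, the third keeps the moved
    reference within reach of the deadbeat controller\<close>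
  define l where "l = min 1 (min (c / (72 * C)) (\<rho> / (6 * G)))"
  have l: "0 < l" "l \<le> 1" "l \<le> c / (72 * C)" "l \<le> \<rho> / (6 * G)"
    using c(1) C \<rho> G by (simp_all add: l_def)
  have l': "72 * C * l \<le> c" "6 * G * l \<le> \<rho>"
    using l(3,4) C G by (simp_all add: field_simps)
  define K where "K = 8 * C / (l * c)"
  have K: "0 < K" using C l c by (simp add: K_def)
  have "(norm (hvec (harm (zo x)) - hvec h0))\<^sup>2 \<le> K * (norm (x - x_harm P (harm (zo x)) 0))\<^sup>2"
    if x: "x \<in> X" "val x \<le> V" and near: "norm (x - x_harm P (harm (zo x)) 0) \<le> \<rho> / 2" for x
  proof -
    define h where "h = harm (zo x)"
    define d where "d = norm (x - x_harm P h 0)"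
    define g where "g = norm (hvec h - hvec h0)"
    have h: "harmonic_constraints P h"
      using opt_decision_feasible[OF x(1)] by (simp add: h_def hmpc_feasible_def)
    have g0: "0 \<le> g" and d0: "0 \<le> d" by (simp_all add: g_def d_def)
    have excess: "c * g\<^sup>2 / 2 \<le> off h - off h0"
      using offset_excess_lower[OF opt h] c(2)[of "hdiff h h0"] by (simp add: g_def hvec_hdiff)
    have off_le: "off h \<le> val x"
      using opt_value_ge[of x] stage_cost_nonneg[of "zo x" 0] by (simp add: h_def)
    have "c * g\<^sup>2 \<le> 2 * \<bar>V\<bar>"
      using excess off_le x(2) offset_cost_nonneg[of xr ur h0] by argo
    then have "g\<^sup>2 \<le> 2 * \<bar>V\<bar> / c" using c(1) by (simp add: field_simps)
    then have "g \<le> G" unfolding G_def using real_le_rsqrt by fastforce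
    define hl where "hl = hcomb l h h0"
    have hl: "harmonic_constraints P hl"
      unfolding hl_def using l by (intro harmonic_constraints_hcomb h h0) auto
    have dist: "norm (x - x_harm P hl 0) \<le> d + 3 * l * g"
    proof -
      have "x - x_harm P hl 0 = (x - x_harm P h 0) + l *\<^sub>R x_harm P (hdiff h h0) 0"
        by (simp add: hl_def x_harm_hcomb x_harm_hdiff algebra_simps)
      also have "norm \<dots> \<le> d + l * norm (x_harm P (hdiff h h0) 0)"
        using norm_triangle_ineq[of "x - x_harm P h 0" "l *\<^sub>R x_harm P (hdiff h h0) 0"] l(1)
        by (simp add: d_def)
      also have "\<dots> \<le> d + l * (3 * g)"
        using norm_x_harm_le[of P "hdiff h h0" 0] l(1)
        by (intro add_left_mono mult_left_mono) (auto simp: g_def hvec_hdiff)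
      finally show ?thesis by (simp add: mult_ac)
    qed
    have "3 * l * g \<le> 3 * l * G" using \<open>g \<le> G\<close> l(1) by simp
    then have "norm (x - x_harm P hl 0) \<le> \<rho>"
      using dist near l'(2) by (simp add: d_def h_def algebra_simps)
    from cand[OF hl this, of xr ur] obtain z where z: "hmpc_feasible P x z"
      "hmpc_cost P xr ur z \<le> off hl + C * (norm (x - x_harm P hl 0))\<^sup>2" by blast
    have "C * (norm (x - x_harm P hl 0))\<^sup>2 \<le> C * (2 * d\<^sup>2 + 2 * (3 * l * g)\<^sup>2)"
      using C power_mono[OF dist, of 2] power2_add_le[of d "3 * l * g"]
      by (intro mult_left_mono) auto
    also have "\<dots> = 2 * C * d\<^sup>2 + 18 * C * l * (l * g\<^sup>2)"
      by (simp add: power2_eq_square algebra_simps)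
    also have "18 * C * l * (l * g\<^sup>2) \<le> c / 4 * (l * g\<^sup>2)"
      using l'(1) l(1) by (intro mult_right_mono) auto
    finally have "C * (norm (x - x_harm P hl 0))\<^sup>2 \<le> 2 * C * d\<^sup>2 + c / 4 * (l * g\<^sup>2)"
      by simp
    moreover have "off hl \<le> off h - l * (c * g\<^sup>2 / 2)"
    proof -
      have "off hl \<le> (1 - l) * off h + l * off h0"
        using l offset_cost_nonneg[of 0 0 "hdiff h h0"] by (simp add: hl_def offset_cost_hcomb)
      also have "\<dots> = off h - l * (off h - off h0)" by (simp add: algebra_simps)
      also have "\<dots> \<le> off h - l * (c * g\<^sup>2 / 2)"
        using mult_left_mono[OF excess, of l] l(1) by linarith
      finally show ?thesis .
    qed
    moreover have "off h \<le> off hl + C * (norm (x - x_harm P hl 0))\<^sup>2"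
      using off_le opt_value_le[OF z(1)] z(2) by linarith
    moreover have "l * (c * g\<^sup>2 / 2) = 2 * (c / 4 * (l * g\<^sup>2))" by simp
    ultimately have "c / 4 * (l * g\<^sup>2) \<le> 2 * C * d\<^sup>2" by linarith
    then have "g\<^sup>2 \<le> K * d\<^sup>2"
      using c(1) l(1) by (simp add: K_def field_simps)
    then show ?thesis by (simp add: g_def d_def h_def)
  qed
  with \<rho> K show ?thesis using that[of "\<rho> / 2" K] by simp
qed

text \<open>
  Deleting the oscillating parts of a harmonic reference preserves its constraints and does not
  increase its offset cost, so the optimal reference is constant; the constant references
  that satisfy the constraints are the admissible steady states.
\<close>

lemma optimal_harmonic_constant:
  assumes opt: "optimal_harmonic P xr ur h"
  shows "xs h = 0" "xc h = 0" "us h = 0" "uc h = 0"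
    and "optimal_steady_state P xr ur (xe h, ue h)"
proof -
  have H: "harmonic_constraints P h"
    and min: "\<And>k. harmonic_constraints P k \<Longrightarrow> off h \<le> off k"
    using opt unfolding optimal_harmonic_def is_arg_min_linorder by blast+
  define cst :: "real^'n \<Rightarrow> real^'m \<Rightarrow> ('n, 'm) harmonic" where
    "cst x u = \<lparr>xe = x, xs = 0, xc = 0, ue = u, us = 0, uc = 0\<rparr>" for x u
  have cst: "harmonic_constraints P (cst x u) \<longleftrightarrow> admissible_steady_state P (x, u)" for x u
    by (auto simp: harmonic_constraints_iff cst_def admissible_steady_state_def less_eq_vec_def
        algebra_simps)
  have cost: "off (cst x u) = sq_wnorm (mTe P) (x - xr) + sq_wnorm (mSe P) (u - ur)" for x u
    by (simp add: offset_cost_def cst_def)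
  have "harmonic_constraints P (cst (xe h) (ue h))"
  proof -
    let ?r = "\<lambda>i. sqrt (((mE P *v xs h + mF P *v us h) $ i)\<^sup>2 + ((mE P *v xc h + mF P *v uc h) $ i)\<^sup>2)"
    have "0 \<le> ?r i" "?r i \<le> (mE P *v xe h + mF P *v ue h) $ i - ylo P $ i - eps P $ i"
      "?r i \<le> yhi P $ i - eps P $ i - (mE P *v xe h + mF P *v ue h) $ i" for i
      using H unfolding harmonic_constraints_iff by (blast | simp)+
    then have "0 \<le> (mE P *v xe h + mF P *v ue h) $ i - ylo P $ i - eps P $ i"
      "0 \<le> yhi P $ i - eps P $ i - (mE P *v xe h + mF P *v ue h) $ i" for i
      using order_trans by blast+
    then show ?thesis
      using H unfolding harmonic_constraints_iff by (simp add: cst_def)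
  qed
  moreover have "off (cst (xe h) (ue h)) \<le> off h"
    unfolding offset_cost_def by (simp add: cst_def sq_wnorm_nonneg Th Sh)
  ultimately have "optimal_harmonic P xr ur (cst (xe h) (ue h))"
    using min unfolding optimal_harmonic_def is_arg_min_linorder by (meson order_trans)
  then have "h = cst (xe h) (ue h)" using opt by (rule optimal_harmonic_unique[rotated])
  then have "xs h = xs (cst (xe h) (ue h))" "xc h = xc (cst (xe h) (ue h))"
    "us h = us (cst (xe h) (ue h))" "uc h = uc (cst (xe h) (ue h))" by simp_all
  then show zero: "xs h = 0" "xc h = 0" "us h = 0" "uc h = 0"
    by (simp_all add: cst_def)
  then have "cst (xe h) (ue h) = h" by (simp add: cst_def)
  then show "optimal_steady_state P xr ur (xe h, ue h)"
    using H min cst cost unfolding optimal_steady_state_def is_arg_min_linorder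
    by (metis (mono_tags, lifting) case_prod_conv prod.exhaust)
qed

lemma harm_optimal_constant:
  assumes "optimal_harmonic P xr ur h"
  shows "x_harm P h j = xe h" "u_harm P h j = ue h"
  using optimal_harmonic_constant[OF assms] by (simp_all add: x_harm_def u_harm_def)

lemma opt_value_lower:
  assumes opt: "optimal_harmonic P xr ur h0"
  obtains k where "0 < k"
    "\<And>x. x \<in> X \<Longrightarrow> k * (norm (x - xe h0))\<^sup>2 \<le> val x - off h0"
proof -
  obtain a where a: "0 < a" "\<And>z j. a * (norm (xseq z j - x_harm P (harm z) j))\<^sup>2 \<le> stage_cost P z j"
    using stage_cost_lower by metis
  obtain c where c: "0 < c" "\<And>h. c * (norm (hvec h))\<^sup>2 \<le> offset_cost P 0 0 h"
    using offset_cost_lower by blast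
  define k where "k = min (a / 2) (c / 36)"
  have k: "0 < k" "2 * k \<le> a" "36 * k \<le> c" using a c by (auto simp: k_def)
  have "k * (norm (x - xe h0))\<^sup>2 \<le> val x - off h0" if x: "x \<in> X" for x
  proof -
    define h where "h = harm (zo x)"
    define d where "d = norm (x - x_harm P h 0)"
    define g where "g = norm (hvec h - hvec h0)"
    have feas: "hmpc_feasible P x (zo x)" using opt_decision_feasible[OF x] .
    have h: "harmonic_constraints P h" using feas by (simp add: h_def hmpc_feasible_def)
    have "a * d\<^sup>2 \<le> stage_cost P (zo x) 0"
      using a(2)[of "zo x" 0] feas by (simp add: d_def h_def hmpc_feasible_def)
    moreover have "c * g\<^sup>2 / 2 \<le> off h - off h0"
      using offset_excess_lower[OF opt h] c(2)[of "hdiff h h0"] by (simp add: g_def hvec_hdiff)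
    ultimately have val: "a * d\<^sup>2 + c * g\<^sup>2 / 2 \<le> val x - off h0"
      using opt_value_ge[of x] unfolding h_def by linarith
    have "x - xe h0 = (x - x_harm P h 0) + x_harm P (hdiff h h0) 0"
      by (simp add: x_harm_hdiff harm_optimal_constant[OF opt])
    then have "norm (x - xe h0) \<le> d + norm (x_harm P (hdiff h h0) 0)"
      unfolding d_def by (simp only: norm_triangle_ineq)
    also have "\<dots> \<le> d + 3 * g"
      using norm_x_harm_le[of P "hdiff h h0" 0] by (simp add: g_def hvec_hdiff)
    finally have "(norm (x - xe h0))\<^sup>2 \<le> (d + 3 * g)\<^sup>2" by (intro power_mono) auto
    also have "\<dots> \<le> 2 * d\<^sup>2 + 18 * g\<^sup>2"
      using power2_add_le[of d "3 * g"] by (simp add: power_mult_distrib)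
    finally have "k * (norm (x - xe h0))\<^sup>2 \<le> k * (2 * d\<^sup>2 + 18 * g\<^sup>2)"
      using k(1) by simp
    also have "\<dots> = 2 * k * d\<^sup>2 + 36 * k * g\<^sup>2 / 2" by (simp add: algebra_simps)
    also have "\<dots> \<le> a * d\<^sup>2 + c * g\<^sup>2 / 2"
      using k by (intro add_mono divide_right_mono mult_right_mono) auto
    finally show ?thesis using val by linarith
  qed
  with k that show ?thesis by blast
qed

lemma opt_value_upper:
  assumes opt: "optimal_harmonic P xr ur h0"
  obtains \<rho> C where "0 < \<rho>" "0 < C"
    "\<And>x. norm (x - xe h0) \<le> \<rho> \<Longrightarrow> x \<in> X \<and> val x \<le> off h0 + C * (norm (x - xe h0))\<^sup>2"
proof -
  obtain \<rho> C where \<rho>: "0 < \<rho>" and C: "0 < C" and cand: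
    "\<And>xr ur h x. harmonic_constraints P h \<Longrightarrow> norm (x - x_harm P h 0) \<le> \<rho> \<Longrightarrow>
       \<exists>z. hmpc_feasible P x z \<and> harm z = h \<and>
           hmpc_cost P xr ur z \<le> offset_cost P xr ur h + C * (norm (x - x_harm P h 0))\<^sup>2"
    using deadbeat_candidate by blast
  have h0: "harmonic_constraints P h0"
    using opt unfolding optimal_harmonic_def is_arg_min_linorder by blast
  have "x \<in> X \<and> val x \<le> off h0 + C * (norm (x - xe h0))\<^sup>2" if near: "norm (x - xe h0) \<le> \<rho>" for x
  proof -
    obtain z where "hmpc_feasible P x z" "hmpc_cost P xr ur z \<le> off h0 + C * (norm (x - xe h0))\<^sup>2"
      using cand[OF h0, of x xr ur] near unfolding harm_optimal_constant[OF opt] by blast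
    then show ?thesis
      using opt_value_le[of x z] by (auto simp: feasibility_region_def)
  qed
  with \<rho> C that show ?thesis by blast
qed

text \<open>
  At the optimal steady state the optimal value is the minimal offset cost; it cannot increase in
  one step, and only this state attains it.
\<close>

lemma closed_loop_equilibrium:
  assumes opt: "optimal_harmonic P xr ur h0"
  shows "xe h0 \<in> X" "step (xe h0) = xe h0"
proof -
  obtain \<rho> C where "0 < \<rho>"
    "\<And>x. norm (x - xe h0) \<le> \<rho> \<Longrightarrow> x \<in> X \<and> val x \<le> off h0 + C * (norm (x - xe h0))\<^sup>2"
    using opt_value_upper[OF opt] by metis
  from this(2)[of "xe h0"] this(1) have X: "xe h0 \<in> X" and val: "val (xe h0) \<le> off h0" by auto
  from X show "xe h0 \<in> X" .
  obtain k where k: "0 < k" "\<And>x. x \<in> X \<Longrightarrow> k * (norm (x - xe h0))\<^sup>2 \<le> val x - off h0"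
    using opt_value_lower[OF opt] by blast
  have "val (step (xe h0)) \<le> off h0"
    using closed_loop_decrease(2)[OF X] stage_cost_nonneg[of "zo (xe h0)" 0] val by linarith
  with k(2)[OF closed_loop_decrease(1)[OF X]] have "k * (norm (step (xe h0) - xe h0))\<^sup>2 \<le> 0" by simp
  with k(1) show "step (xe h0) = xe h0" by (simp add: mult_le_0_iff)
qed

text \<open>
  The optimal value minus the minimal offset cost is a Lyapunov function: it does not increase, and
  near the equilibrium it lies between two multiples of the squared distance.
\<close>

lemma closed_loop_stable:
  assumes opt: "optimal_harmonic P xr ur h0"
  shows "lyapunov_stable step X (xe h0)"
  unfolding lyapunov_stable_def
proof (intro conjI ballI allI impI)
  fix \<epsilon> :: real assume \<epsilon>: "0 < \<epsilon>"
  obtain \<rho> C where \<rho>: "0 < \<rho>" and C: "0 < C" and up: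
    "\<And>x. norm (x - xe h0) \<le> \<rho> \<Longrightarrow> x \<in> X \<and> val x \<le> off h0 + C * (norm (x - xe h0))\<^sup>2"
    using opt_value_upper[OF opt] by blast
  obtain k where k: "0 < k" "\<And>x. x \<in> X \<Longrightarrow> k * (norm (x - xe h0))\<^sup>2 \<le> val x - off h0"
    using opt_value_lower[OF opt] by blast
  define \<delta> where "\<delta> = min \<rho> (\<epsilon> * sqrt (k / C))"
  have \<delta>: "0 < \<delta>" using \<rho> \<epsilon> k C by (simp add: \<delta>_def)
  have "dist ((step ^^ t) x) (xe h0) < \<epsilon>" if x: "x \<in> X" and near: "dist x (xe h0) < \<delta>" for x t
  proof -
    let ?n = "norm (x - xe h0)"
    have n: "?n < \<delta>" using near by (simp add: dist_norm)
    have "k * (norm (state_at P xr ur x t - xe h0))\<^sup>2 \<le> val (state_at P xr ur x t) - off h0"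
      by (rule k(2)[OF state_at_feasible[OF x]])
    also have "\<dots> \<le> val x - off h0" using opt_value_antimono[OF x, of t] by simp
    also have "\<dots> \<le> C * ?n\<^sup>2" using up[of x] n by (simp add: \<delta>_def)
    also have "\<dots> < C * (\<epsilon> * sqrt (k / C))\<^sup>2"
      using n C by (intro mult_strict_left_mono power_strict_mono) (auto simp: \<delta>_def)
    also have "\<dots> = k * \<epsilon>\<^sup>2"
      using k C by (simp add: power_mult_distrib)
    finally have "(norm (state_at P xr ur x t - xe h0))\<^sup>2 < \<epsilon>\<^sup>2" using k(1) by simp
    then have "norm (state_at P xr ur x t - xe h0) < \<epsilon>"
      using \<epsilon> by (simp add: power_less_imp_less_base)
    then show ?thesis by (simp add: dist_norm state_at_def)
  qed
  with \<delta> show "\<exists>\<delta>>0. \<forall>x\<in>X. dist x (xe h0) < \<delta> \<longrightarrow> (\<forall>t. dist ((step ^^ t) x) (xe h0) < \<epsilon>)"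
    by blast
qed (use closed_loop_decrease(1) closed_loop_equilibrium[OF opt] in auto)

lemma closed_loop_converges:
  assumes opt: "optimal_harmonic P xr ur h0" and x: "x \<in> X"
  shows "state_at P xr ur x \<longlonglongrightarrow> xe h0" "input_at P xr ur x \<longlonglongrightarrow> ue h0"
proof -
  define s where "s = state_at P xr ur x"
  define z where "z t = zo (s t)" for t
  have sX: "s t \<in> X" for t unfolding s_def by (rule state_at_feasible[OF x])
  have x0: "xseq (z t) 0 = s t" for t
    using opt_decision_feasible[OF sX[of t]] by (simp add: z_def hmpc_feasible_def)
  have stage: "(\<lambda>t. stage_cost P (z t) 0) \<longlonglongrightarrow> 0"
    using stage_cost_tendsto_zero[OF x] by (simp add: z_def s_def)
  obtain a where a: "0 < a" "\<And>z j. a * (norm (xseq z j - x_harm P (harm z) j))\<^sup>2 \<le> stage_cost P z j"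
    "\<And>z j. a * (norm (useq z j - u_harm P (harm z) j))\<^sup>2 \<le> stage_cost P z j"
    using stage_cost_lower by blast
  have to_zero: "f \<longlonglongrightarrow> 0" if "\<And>t. b * (norm (f t))\<^sup>2 \<le> e t" "e \<longlonglongrightarrow> 0" "0 < b"
    for f :: "nat \<Rightarrow> 'x::real_normed_vector" and e b
  proof -
    have lim: "(\<lambda>t. sqrt (e t / b)) \<longlonglongrightarrow> 0"
      using tendsto_real_sqrt[OF tendsto_divide[OF that(2) tendsto_const, of b]] that(3) by simp
    have "norm (f t) \<le> sqrt (e t / b)" for t
      using that(1)[of t] that(3) by (intro real_le_rsqrt) (simp add: field_simps)
    then show ?thesis
      by (intro Lim_null_comparison[OF _ lim]) simp
  qed
  have dx: "(\<lambda>t. s t - x_harm P (harm (z t)) 0) \<longlonglongrightarrow> 0"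
    by (rule to_zero[OF _ stage a(1)]) (use a(2)[of "z _" 0] in \<open>simp add: x0\<close>)
  have du: "(\<lambda>t. useq (z t) 0 - u_harm P (harm (z t)) 0) \<longlonglongrightarrow> 0"
    by (rule to_zero[OF _ stage a(1)]) (rule a(3))
  obtain \<delta> K where \<delta>: "0 < \<delta>" and K: "0 < K" and gap:
    "\<And>y. y \<in> X \<Longrightarrow> val y \<le> val x \<Longrightarrow> norm (y - x_harm P (harm (zo y)) 0) \<le> \<delta> \<Longrightarrow>
       (norm (hvec (harm (zo y)) - hvec h0))\<^sup>2 \<le> K * (norm (y - x_harm P (harm (zo y)) 0))\<^sup>2"
    using harmonic_gap_bound[OF opt, of "val x"] by blast
  have "\<forall>\<^sub>F t in sequentially. norm (s t - x_harm P (harm (z t)) 0) < \<delta>"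
    using tendstoD[OF dx \<delta>] by simp
  then have "\<forall>\<^sub>F t in sequentially. norm (hvec (harm (z t)) - hvec h0)
      \<le> sqrt K * norm (s t - x_harm P (harm (z t)) 0)"
  proof eventually_elim
    case (elim t)
    have "(norm (hvec (harm (z t)) - hvec h0))\<^sup>2 \<le> K * (norm (s t - x_harm P (harm (z t)) 0))\<^sup>2"
      using gap[OF sX[of t]] opt_value_antimono[OF x, of t] elim by (simp add: z_def s_def)
    then have "norm (hvec (harm (z t)) - hvec h0) \<le> sqrt (K * (norm (s t - x_harm P (harm (z t)) 0))\<^sup>2)"
      by (rule real_le_rsqrt)
    then show ?case by (simp add: real_sqrt_mult)
  qed
  moreover have "(\<lambda>t. sqrt K * norm (s t - x_harm P (harm (z t)) 0)) \<longlonglongrightarrow> 0"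
    using tendsto_mult_left[OF tendsto_norm[OF dx], of "sqrt K"] by simp
  ultimately have "(\<lambda>t. hvec (harm (z t)) - hvec h0) \<longlonglongrightarrow> 0"
    by (rule Lim_null_comparison)
  then have h: "(\<lambda>t. hvec (harm (z t))) \<longlonglongrightarrow> hvec h0"
    by (rule LIM_zero_cancel)
  have "(\<lambda>t. s t - x_harm P (harm (z t)) 0 + x_harm P (harm (z t)) 0) \<longlonglongrightarrow> 0 + x_harm P h0 0"
    by (intro tendsto_add dx tendsto_harm[OF h])
  then show "state_at P xr ur x \<longlonglongrightarrow> xe h0"
    by (simp add: harm_optimal_constant[OF opt] s_def)
  have "(\<lambda>t. useq (z t) 0 - u_harm P (harm (z t)) 0 + u_harm P (harm (z t)) 0)
      \<longlonglongrightarrow> 0 + u_harm P h0 0"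
    by (intro tendsto_add du tendsto_harm[OF h])
  moreover have "input_at P xr ur x = (\<lambda>t. useq (z t) 0)"
    using hmpc_law_eq[OF sX] by (simp add: fun_eq_iff input_at_def s_def z_def)
  ultimately show "input_at P xr ur x \<longlonglongrightarrow> ue h0"
    by (simp add: harm_optimal_constant[OF opt])
qed

end

end
theorem theorem6p15:
  fixes P :: "('n::finite, 'm::finite, 'p::finite) hmpc"
    and xr :: "real^'n" and ur :: "real^'m" and x0 :: "real^'n"
  assumes "controllable (mA P) (mB P)"
    and "interior (constraint_set P) \<noteq> {}"
    and "\<And>i. 0 < eps P $ i"
    and "\<And>i. ylo P $ i + eps P $ i < yhi P $ i - eps P $ i"
    and "sym_pos_def (mQ P)" and "sym_pos_def (mR P)"
    and "diag_pos_def (mTe P)" and "diag_pos_def (mTh P)"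
    and "diag_pos_def (mSe P)" and "diag_pos_def (mSh P)"
    and "1 \<le> horizon P" and "0 \<le> freq P"
    and "controllability_index (mA P) (mB P) \<le> horizon P"
    and "x0 \<in> feasibility_region P"
  shows "\<exists>h.
      \<comment> \<open>the optimal artificial harmonic reference, which is an admissible steady state\<close>
      (\<forall>h'. optimal_harmonic P xr ur h' \<longleftrightarrow> h' = h) \<and>
      (\<forall>j. x_harm P h j = xe h \<and> u_harm P h j = ue h) \<and>
      optimal_steady_state P xr ur (xe h, ue h) \<and>
      \<comment> \<open>the control law is well defined along the closed loop\<close>
      (\<forall>t. \<exists>!v. is_optimal_input P xr ur (state_at P xr ur x0 t) v) \<and>
      \<comment> \<open>stability\<close>
      lyapunov_stable (closed_loop P xr ur) (feasibility_region P) (xe h) \<and>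
      \<comment> \<open>constraint satisfaction\<close>
      (\<forall>t. (state_at P xr ur x0 t, input_at P xr ur x0 t) \<in> constraint_set P) \<and>
      \<comment> \<open>convergence\<close>
      state_at P xr ur x0 \<longlonglongrightarrow> xe h \<and>
      input_at P xr ur x0 \<longlonglongrightarrow> ue h"
proof -
  interpret hmpc_setup P
    using assms by unfold_locales (auto simp: diag_pos_def_def)
  obtain z where "hmpc_feasible P x0 z"
    using assms(14) by (auto simp: feasibility_region_def)
  then have "harmonic_constraints P (harm z)" by (simp add: hmpc_feasible_def)
  then obtain h where h: "optimal_harmonic P xr ur h"
    using optimal_harmonic_exists by blast
  have "\<forall>h'. optimal_harmonic P xr ur h' \<longleftrightarrow> h' = h"
    using h optimal_harmonic_unique by blast
  moreover have "\<forall>t. \<exists>!v. is_optimal_input P xr ur (state_at P xr ur x0 t) v"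
    using is_optimal_input_iff[OF state_at_feasible[OF assms(14)]] by simp
  moreover have "\<forall>t. (state_at P xr ur x0 t, input_at P xr ur x0 t) \<in> constraint_set P"
    unfolding input_at_def using hmpc_law_admissible[OF state_at_feasible[OF assms(14)]] by blast
  ultimately show ?thesis
    using harm_optimal_constant[OF h] optimal_harmonic_constant(5)[OF h] closed_loop_stable[OF h]
      closed_loop_converges[OF h assms(14)] by blast
qed

end
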